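(* Let $M$ be a minimal surface of the unit sphere $\mathbb{S}^4\subset\mathbb{R}^5$ such that the second fundamental form of $M$ in $\mathbb{S}^4$ spans the normal space of $M$ in $\mathbb{S}^4$ at each point. Then, for any unit normal section $\eta$ of $M$ in $\mathbb{S}^4$, the Gauss map $$\gamma_\eta:M\to\mathbb{S}^4,\qquad p\mapsto\eta(p),$$ is not a harmonic map.
   Context: $M$ is an immersed surface; $\eta(p)\in T_p\mathbb{S}^4\subset\mathbb{R}^5$ is a unit vector orthogonal to $T_pM$, regarded as a point of $\mathbb{S}^4$. A map from $M$ to a unit sphere $\mathbb{S}^{m-1}$ is harmonic if it is a critical point of $f\mapsto\int_D\|df\|^2$ on compact subdomains $D\subset M$ among maps into $\mathbb{S}^{m-1}$ (equivalently $\Delta f=-\|df\|^2 f$). The second fundamental form $B$ spans the normal space at $p$ if $\mathrm{span}\{B(X,Y): X,Y\in T_pM\}$ is the whole normal space at $p$. *)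

theory Defs
  imports "HOL-Analysis.Analysis"
begin

text \<open>
  A surface is the whole of a Hausdorff, second countable type \<open>'m\<close> with a smooth atlas of charts
  into the plane. A chart is a pair \<open>(U, \<phi>)\<close>; the values of \<open>\<phi>\<close> outside \<open>U\<close> are irrelevant.
  A tangent vector at \<open>p\<close> is represented by its coordinate vector in \<open>real^2\<close> with respect to
  a chart around \<open>p\<close>.
\<close>

primrec C_k_on :: "nat \<Rightarrow> 'a::real_normed_vector set \<Rightarrow> ('a \<Rightarrow> 'b::real_normed_vector) \<Rightarrow> bool" where
  "C_k_on 0 S f \<longleftrightarrow> continuous_on S f"
| "C_k_on (Suc k) S f \<longleftrightarrow> (\<forall>u\<in>S. f differentiable (at u)) \<and>
     (\<forall>v. C_k_on k S (\<lambda>u. frechet_derivative f (at u) v))"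

text \<open>Only meant for open \<open>S\<close> in finite dimension, where it is the usual notion \<open>C\<^sup>\<infinity>\<close>.\<close>

definition smooth_on :: "'a::real_normed_vector set \<Rightarrow> ('a \<Rightarrow> 'b::real_normed_vector) \<Rightarrow> bool" where
  "smooth_on S f \<longleftrightarrow> (\<forall>k. C_k_on k S f)"

type_synonym 'm chart = "'m set \<times> ('m \<Rightarrow> real^2)"

abbreviation chart_dom :: "'m chart \<Rightarrow> 'm set" where
  "chart_dom c \<equiv> fst c"

abbreviation chart_map :: "'m chart \<Rightarrow> 'm \<Rightarrow> real^2" where
  "chart_map c \<equiv> snd c"

definition chart_image :: "'m chart \<Rightarrow> (real^2) set" where
  "chart_image c = chart_map c ` chart_dom c"

definition chart_inv :: "'m chart \<Rightarrow> real^2 \<Rightarrow> 'm" where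
  "chart_inv c = inv_into (chart_dom c) (chart_map c)"

definition smooth_atlas :: "'m::topological_space chart set \<Rightarrow> bool" where
  "smooth_atlas \<A> \<longleftrightarrow>
     (\<Union>c\<in>\<A>. chart_dom c) = UNIV \<and>
     (\<forall>c\<in>\<A>. open (chart_dom c) \<and> open (chart_image c) \<and>
        homeomorphism (chart_dom c) (chart_image c) (chart_map c) (chart_inv c)) \<and>
     (\<forall>c\<in>\<A>. \<forall>d\<in>\<A>.
        smooth_on (chart_map c ` (chart_dom c \<inter> chart_dom d)) (chart_map d \<circ> chart_inv c))"

definition local_rep :: "'m chart \<Rightarrow> ('m \<Rightarrow> 'b) \<Rightarrow> real^2 \<Rightarrow> 'b" where
  "local_rep c f = f \<circ> chart_inv c"

definition smooth_map :: "'m::topological_space chart set \<Rightarrow> ('m \<Rightarrow> 'b::real_normed_vector) \<Rightarrow> bool" where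
  "smooth_map \<A> f \<longleftrightarrow> (\<forall>c\<in>\<A>. smooth_on (chart_image c) (local_rep c f))"

definition differential ::
  "'m chart \<Rightarrow> ('m \<Rightarrow> 'b::real_normed_vector) \<Rightarrow> 'm \<Rightarrow> real^2 \<Rightarrow> 'b" where
  "differential c f p = frechet_derivative (local_rep c f) (at (chart_map c p))"

definition immersed_in_sphere ::
  "'m::topological_space chart set \<Rightarrow> ('m \<Rightarrow> 'b::euclidean_space) \<Rightarrow> bool" where
  "immersed_in_sphere \<A> x \<longleftrightarrow> smooth_map \<A> x \<and> (\<forall>p. x p \<in> sphere 0 1) \<and>
     (\<forall>c\<in>\<A>. \<forall>p\<in>chart_dom c. inj (differential c x p))"

text \<open>
  The normal space of the surface in the unit sphere: vectors tangent to the sphere at \<open>x p\<close>, i.e.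
  orthogonal to \<open>x p\<close>, and orthogonal to the tangent plane of the surface.
\<close>

definition normal_space :: "'m chart \<Rightarrow> ('m \<Rightarrow> 'b::euclidean_space) \<Rightarrow> 'm \<Rightarrow> 'b set" where
  "normal_space c x p = {n. n \<bullet> x p = 0 \<and> (\<forall>v. n \<bullet> differential c x p v = 0)}"

definition orth_proj :: "'b::euclidean_space set \<Rightarrow> 'b \<Rightarrow> 'b" where
  "orth_proj W a = (THE n. n \<in> W \<and> (\<forall>w\<in>W. orthogonal (a - n) w))"

text \<open>
  The second fundamental form in the sphere. The vectors \<open>v\<close> and \<open>w\<close> are extended to fields with
  constant coordinates; the covariant derivative of the ambient sphere is the flat derivative
  projected orthogonally to \<open>x p\<close>, and that projection is subsumed by the one onto the normal space.
\<close>

definition second_fundamental_form ::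
  "'m chart \<Rightarrow> ('m \<Rightarrow> 'b::euclidean_space) \<Rightarrow> 'm \<Rightarrow> real^2 \<Rightarrow> real^2 \<Rightarrow> 'b" where
  "second_fundamental_form c x p v w =
     orth_proj (normal_space c x p)
       (frechet_derivative (\<lambda>u. frechet_derivative (local_rep c x) (at u) w) (at (chart_map c p)) v)"

definition gram :: "'m chart \<Rightarrow> ('m \<Rightarrow> 'b::euclidean_space) \<Rightarrow> 'm \<Rightarrow> real^2^2" where
  "gram c x p = (\<chi> i j. differential c x p (axis i 1) \<bullet> differential c x p (axis j 1))"

definition mean_curvature :: "'m chart \<Rightarrow> ('m \<Rightarrow> 'b::euclidean_space) \<Rightarrow> 'm \<Rightarrow> 'b" where
  "mean_curvature c x p = (1/2) *\<^sub>R (\<Sum>i\<in>UNIV. \<Sum>j\<in>UNIV.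
     (matrix_inv (gram c x p) $ i $ j) *\<^sub>R second_fundamental_form c x p (axis i 1) (axis j 1))"

definition minimal_in_sphere ::
  "'m::topological_space chart set \<Rightarrow> ('m \<Rightarrow> 'b::euclidean_space) \<Rightarrow> bool" where
  "minimal_in_sphere \<A> x \<longleftrightarrow> immersed_in_sphere \<A> x \<and>
     (\<forall>c\<in>\<A>. \<forall>p\<in>chart_dom c. mean_curvature c x p = 0)"

definition second_fundamental_form_spans ::
  "'m::topological_space chart set \<Rightarrow> ('m \<Rightarrow> 'b::euclidean_space) \<Rightarrow> bool" where
  "second_fundamental_form_spans \<A> x \<longleftrightarrow> (\<forall>c\<in>\<A>. \<forall>p\<in>chart_dom c.
     span {second_fundamental_form c x p v w | v w. True} = normal_space c x p)"

definition unit_normal_section ::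
  "'m::topological_space chart set \<Rightarrow> ('m \<Rightarrow> 'b::euclidean_space) \<Rightarrow> ('m \<Rightarrow> 'b) \<Rightarrow> bool" where
  "unit_normal_section \<A> x \<eta> \<longleftrightarrow> smooth_map \<A> \<eta> \<and> (\<forall>p. norm (\<eta> p) = 1) \<and>
     (\<forall>c\<in>\<A>. \<forall>p\<in>chart_dom c. \<eta> p \<in> normal_space c x p)"

text \<open>The squared Hilbert-Schmidt norm of \<open>df\<close> with respect to the metric induced by \<open>x\<close>.\<close>

definition energy_density ::
  "'m chart \<Rightarrow> ('m \<Rightarrow> 'b::euclidean_space) \<Rightarrow> ('m \<Rightarrow> 'c::euclidean_space) \<Rightarrow> 'm \<Rightarrow> real" where
  "energy_density c x f p = (\<Sum>i\<in>UNIV. \<Sum>j\<in>UNIV. matrix_inv (gram c x p) $ i $ j *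
     (differential c f p (axis i 1) \<bullet> differential c f p (axis j 1)))"

definition energy_integrand ::
  "'m chart \<Rightarrow> ('m \<Rightarrow> 'b::euclidean_space) \<Rightarrow> ('m \<Rightarrow> 'c::euclidean_space) \<Rightarrow> real^2 \<Rightarrow> real" where
  "energy_integrand c x f u =
     energy_density c x f (chart_inv c u) * sqrt (det (gram c x (chart_inv c u)))"

text \<open>
  The integral of \<open>\<parallel>df\<parallel>\<^sup>2\<close> over \<open>D\<close> against the area element of the induced metric. It is computed by
  cutting \<open>D\<close> into finitely many disjoint Borel pieces, each inside a chart domain; the value \<open>E\<close>
  does not depend on the choice of pieces and charts.
\<close>

definition has_energy ::
  "'m::topological_space chart set \<Rightarrow> ('m \<Rightarrow> 'b::euclidean_space) \<Rightarrow>
   ('m \<Rightarrow> 'c::euclidean_space) \<Rightarrow> 'm set \<Rightarrow> real \<Rightarrow> bool" where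
  "has_energy \<A> x f D E \<longleftrightarrow>
     (\<exists>(n::nat) c A. (\<forall>i<n. c i \<in> \<A> \<and> A i \<in> sets borel \<and> A i \<subseteq> chart_dom (c i) \<and>
          set_integrable lborel (chart_map (c i) ` A i) (energy_integrand (c i) x f)) \<and>
        disjoint_family_on A {..<n} \<and> D = (\<Union>i<n. A i) \<and>
        E = (\<Sum>i<n. set_lebesgue_integral lborel (chart_map (c i) ` A i)
               (energy_integrand (c i) x f)))"

definition compact_subdomain :: "'m::topological_space set \<Rightarrow> bool" where
  "compact_subdomain D \<longleftrightarrow> compact D \<and> D = closure (interior D) \<and> connected (interior D)"

text \<open>A smooth variation \<open>F t\<close>, \<open>\<bar>t\<bar> < \<epsilon>\<close>, of \<open>f\<close> through maps into the unit sphere, fixed outside \<open>D\<close>.\<close>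

definition sphere_variation ::
  "'m::topological_space chart set \<Rightarrow> ('m \<Rightarrow> 'c::euclidean_space) \<Rightarrow> 'm set \<Rightarrow> real \<Rightarrow>
   (real \<Rightarrow> 'm \<Rightarrow> 'c) \<Rightarrow> bool" where
  "sphere_variation \<A> f D \<epsilon> F \<longleftrightarrow> F 0 = f \<and>
     (\<forall>c\<in>\<A>. smooth_on ({-\<epsilon><..<\<epsilon>} \<times> chart_image c) (\<lambda>(t, u). F t (chart_inv c u))) \<and>
     (\<forall>t\<in>{-\<epsilon><..<\<epsilon>}. (\<forall>p. F t p \<in> sphere 0 1) \<and> (\<forall>p. p \<notin> D \<longrightarrow> F t p = f p))"

definition harmonic_into_sphere ::
  "'m::topological_space chart set \<Rightarrow> ('m \<Rightarrow> 'b::euclidean_space) \<Rightarrow>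
   ('m \<Rightarrow> 'c::euclidean_space) \<Rightarrow> bool" where
  "harmonic_into_sphere \<A> x f \<longleftrightarrow> smooth_map \<A> f \<and> (\<forall>p. f p \<in> sphere 0 1) \<and>
     (\<forall>D \<epsilon> F E. compact_subdomain D \<longrightarrow> \<epsilon> > 0 \<longrightarrow> sphere_variation \<A> f D \<epsilon> F \<longrightarrow>
        (\<forall>t\<in>{-\<epsilon><..<\<epsilon>}. has_energy \<A> x (F t) D (E t)) \<longrightarrow>
        (E has_real_derivative 0) (at 0))"

end

theory Submission
  imports Defs
begin

text \<open>
  Suppose that the unit normal section \<open>\<eta>\<close> is harmonic. Choose a local unit normal \<open>\<nu>\<close> orthogonal to
  \<open>\<eta>\<close>, an orthonormal tangent frame \<open>v\<close>, \<open>w\<close>, and write \<open>\<omega>\<close> for the connection form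
  \<open>z \<mapsto> \<langle>d\<eta> z, \<nu>\<rangle>\<close>, identified with a tangent vector by the metric. By the Codazzi equation and minimality the tangential part of \<open>\<Delta>\<eta>\<close> is
  \<open>- 2 S\<^sub>\<nu> \<omega>\<close>, where \<open>S\<^sub>\<nu>\<close> is the shape operator in the direction \<open>\<nu>\<close>. Harmonicity makes \<open>\<Delta>\<eta>\<close> a multiple
  of \<open>\<eta>\<close>, so \<open>S\<^sub>\<nu> \<omega> = 0\<close>. The operator \<open>S\<^sub>\<nu>\<close> is symmetric, trace free and, because the second
  fundamental form spans the normal plane, nonzero; hence it is invertible and \<open>\<omega> = 0\<close>. So \<open>\<eta>\<close> is parallel
  in the normal bundle. Then \<open>S\<^sub>\<eta>\<close> and \<open>S\<^sub>\<nu>\<close> commute by the Ricci equation. Commuting trace free symmetric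
  operators of a plane are linearly dependent, so some nonzero combination of \<open>\<eta>\<close> and \<open>\<nu>\<close> is orthogonal
  to every value of the second fundamental form, which contradicts spanning.

  Only variations with tangential velocity are used. A tangent field supported in a coordinate box gives, by
  \<open>first_variation\<close>, an integral identity in the plane; integration by parts against bump functions turns
  it into the pointwise equation \<open>euler_lagrange\<close>. The lemma \<open>stationary_normal_connection\<close> evaluates
  that equation, with the Codazzi equation entering as the symmetry of second derivatives; \<open>dN_conormal\<close>
  concludes \<open>\<omega> = 0\<close>, and \<open>stationary_normal_field.empty\<close> derives the contradiction.

  Coordinates are never adapted to the metric. Instead the Dirichlet integrand is written for an arbitrary
  constant basis of the coordinate plane, and the basis is chosen to be orthonormal at the one
  point where an equation is evaluated; this keeps the algebra short.
\<close>


section \<open>Calculus of smooth maps\<close>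

text \<open>
  The point is the last argument, so that \<open>dir_deriv v f\<close> is again a map and the clauses of
  \<open>C_k_on\<close> iterate it.
\<close>

definition dir_deriv :: "'a::real_normed_vector \<Rightarrow> ('a \<Rightarrow> 'b::real_normed_vector) \<Rightarrow> 'a \<Rightarrow> 'b" where
  "dir_deriv v f u = frechet_derivative f (at u) v"

lemma C_k_on_Suc_iff:
  "C_k_on (Suc k) S f \<longleftrightarrow> (\<forall>u\<in>S. f differentiable (at u)) \<and> (\<forall>v. C_k_on k S (dir_deriv v f))"
  by (simp add: dir_deriv_def[abs_def])

declare C_k_on.simps(2) [simp del]

lemma dir_deriv_eq: "(f has_derivative f') (at u) \<Longrightarrow> dir_deriv v f u = f' v"
  unfolding dir_deriv_def using frechet_derivative_at by metis

lemma has_derivative_dir_deriv: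
  "f differentiable (at u) \<Longrightarrow> (f has_derivative (\<lambda>v. dir_deriv v f u)) (at u)"
  unfolding dir_deriv_def using frechet_derivative_works by blast

lemma dir_deriv_cong:
  assumes "open S" "u \<in> S" "\<And>x. x \<in> S \<Longrightarrow> f x = g x"
  shows "dir_deriv v f u = dir_deriv v g u"
proof -
  have "(f has_derivative d) (at u) \<longleftrightarrow> (g has_derivative d) (at u)" for d
    using has_derivative_transform_within_open[OF _ assms(1,2), of f d UNIV g]
      has_derivative_transform_within_open[OF _ assms(1,2), of g d UNIV f] assms(3) by auto
  then show ?thesis by (simp add: dir_deriv_def frechet_derivative_def)
qed

lemma differentiable_cong_open:
  assumes "open S" "u \<in> S" "\<And>x. x \<in> S \<Longrightarrow> f x = g x" "f differentiable (at u)"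
  shows "g differentiable (at u)"
  using has_derivative_transform_within_open[OF _ assms(1,2), of f _ UNIV g] assms(3,4)
  unfolding differentiable_def by blast

lemma C_k_on_decrease: "C_k_on (Suc k) S f \<Longrightarrow> C_k_on k S f"
proof (induction k arbitrary: f)
  case 0
  then show ?case
    by (auto simp: C_k_on_Suc_iff intro!: continuous_at_imp_continuous_on differentiable_imp_continuous_within)
next
  case (Suc k)
  then show ?case by (subst C_k_on_Suc_iff) (auto simp: C_k_on_Suc_iff[of "Suc k"])
qed

lemma C_k_on_cong:
  assumes "open S" "\<And>x. x \<in> S \<Longrightarrow> f x = g x" "C_k_on k S f"
  shows "C_k_on k S g"
  using assms(2,3)
proof (induction k arbitrary: f g)
  case 0
  then show ?case by (metis C_k_on.simps(1) continuous_on_cong)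
next
  case (Suc k)
  show ?case unfolding C_k_on_Suc_iff
  proof (intro conjI ballI allI)
    fix u assume "u \<in> S"
    then show "g differentiable at u"
      using Suc.prems differentiable_cong_open[OF assms(1), of u f g] by (simp add: C_k_on_Suc_iff)
  next
    fix v
    show "C_k_on k S (dir_deriv v g)"
      by (rule Suc.IH[of "dir_deriv v f"])
        (use Suc.prems dir_deriv_cong[OF assms(1), of _ f g] in \<open>auto simp: C_k_on_Suc_iff\<close>)
  qed
qed

text \<open>
  Differentiability on \<open>S\<close> is a condition at each point of \<open>S\<close>, so it may be checked on neighbourhoods. This
  glues maps that are given by different formulas on overlapping open sets.
\<close>

lemma C_k_on_local:
  assumes "\<And>u. u \<in> S \<Longrightarrow> \<exists>T. open T \<and> u \<in> T \<and> C_k_on k T f"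
  shows "C_k_on k S f"
  using assms
proof (induction k arbitrary: f)
  case 0
  show ?case unfolding C_k_on.simps
    by (rule continuous_at_imp_continuous_on)
      (metis 0 C_k_on.simps(1) continuous_on_eq_continuous_at)
next
  case (Suc k)
  show ?case unfolding C_k_on_Suc_iff
  proof (intro conjI ballI allI)
    fix u assume "u \<in> S"
    then show "f differentiable at u" using Suc.prems by (auto simp: C_k_on_Suc_iff)
  next
    fix v show "C_k_on k S (dir_deriv v f)"
      by (rule Suc.IH) (use Suc.prems in \<open>meson C_k_on_Suc_iff\<close>)
  qed
qed

lemma C_k_on_subset: "C_k_on k S f \<Longrightarrow> T \<subseteq> S \<Longrightarrow> C_k_on k T f"
  by (induction k arbitrary: f) (auto simp: C_k_on_Suc_iff intro: continuous_on_subset)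

lemma C_k_on_const: "C_k_on k S (\<lambda>x. c)"
proof (induction k arbitrary: c)
  case (Suc k)
  have "dir_deriv v (\<lambda>x. c) = (\<lambda>x. 0)" for v :: 'a
    by (rule ext, rule dir_deriv_eq) simp
  with Suc show ?case by (auto simp: C_k_on_Suc_iff)
qed simp

lemma C_k_on_linear:
  assumes "bounded_linear f"
  shows "C_k_on k S f"
proof (cases k)
  case 0
  then show ?thesis by (simp add: assms linear_continuous_on)
next
  case (Suc j)
  have "dir_deriv v f = (\<lambda>x. f v)" for v
    by (rule ext, rule dir_deriv_eq) (simp add: assms bounded_linear_imp_has_derivative)
  then show ?thesis
    by (auto simp: Suc C_k_on_Suc_iff C_k_on_const bounded_linear_imp_differentiable[OF assms])
qed

lemma dir_deriv_add:
  assumes "f differentiable (at u)" "g differentiable (at u)"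
  shows "dir_deriv v (\<lambda>x. f x + g x) u = dir_deriv v f u + dir_deriv v g u"
  by (rule dir_deriv_eq[THEN trans],
      rule has_derivative_add[OF has_derivative_dir_deriv[OF assms(1)] has_derivative_dir_deriv[OF assms(2)]]) simp

lemma dir_deriv_bilinear:
  assumes "bounded_bilinear h" "f differentiable (at u)" "g differentiable (at u)"
  shows "dir_deriv v (\<lambda>x. h (f x) (g x)) u = h (f u) (dir_deriv v g u) + h (dir_deriv v f u) (g u)"
  by (rule dir_deriv_eq[THEN trans],
      rule bounded_bilinear.FDERIV[OF assms(1) has_derivative_dir_deriv[OF assms(2)] has_derivative_dir_deriv[OF assms(3)]]) simp

lemma C_k_on_add:
  assumes "open S" "C_k_on k S f" "C_k_on k S g"
  shows "C_k_on k S (\<lambda>x. f x + g x)"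
  using assms(2,3)
proof (induction k arbitrary: f g)
  case 0
  then show ?case by (simp add: continuous_on_add)
next
  case (Suc k)
  then have "C_k_on k S (\<lambda>x. dir_deriv v f x + dir_deriv v g x)" for v
    by (simp add: C_k_on_Suc_iff)
  then have "C_k_on k S (dir_deriv v (\<lambda>x. f x + g x))" for v
    by (rule C_k_on_cong[OF assms(1), rotated]) (use Suc.prems in \<open>simp add: C_k_on_Suc_iff dir_deriv_add\<close>)
  with Suc.prems show ?case by (simp add: C_k_on_Suc_iff)
qed

lemma C_k_on_bilinear:
  assumes "open S" "bounded_bilinear h" "C_k_on k S f" "C_k_on k S g"
  shows "C_k_on k S (\<lambda>x. h (f x) (g x))"
  using assms(3,4)
proof (induction k arbitrary: f g)
  case 0
  then show ?case by (simp add: bounded_bilinear.continuous_on[OF assms(2)])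
next
  case (Suc k)
  then have "C_k_on k S (\<lambda>x. h (f x) (dir_deriv v g x) + h (dir_deriv v f x) (g x))" for v
    by (intro C_k_on_add assms Suc.IH) (auto simp: C_k_on_Suc_iff[of k] intro: C_k_on_decrease)
  then have "C_k_on k S (dir_deriv v (\<lambda>x. h (f x) (g x)))" for v
    by (rule C_k_on_cong[OF assms(1), rotated])
      (use Suc.prems in \<open>simp add: C_k_on_Suc_iff dir_deriv_bilinear[OF assms(2)]\<close>)
  moreover have "(\<lambda>x. h (f x) (g x)) differentiable (at u)" if "u \<in> S" for u
    using bounded_bilinear.FDERIV[OF assms(2) has_derivative_dir_deriv has_derivative_dir_deriv, of f u g]
      Suc.prems that unfolding C_k_on_Suc_iff differentiable_def by blast
  ultimately show ?case by (simp add: C_k_on_Suc_iff)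
qed

lemma C_k_on_sum:
  assumes "open S" "\<And>i. i \<in> I \<Longrightarrow> C_k_on k S (f i)"
  shows "C_k_on k S (\<lambda>x. \<Sum>i\<in>I. f i x)"
  using assms(2) by (induction I rule: infinite_finite_induct) (auto simp: C_k_on_const C_k_on_add assms(1))

text \<open>The direction in the chain rule varies with the point, so it is expanded in the standard basis.\<close>

lemma dir_deriv_compose:
  fixes f :: "'b::euclidean_space \<Rightarrow> 'c::real_normed_vector" and g :: "'a::real_normed_vector \<Rightarrow> 'b"
  assumes "g differentiable (at u)" "f differentiable (at (g u))"
  shows "dir_deriv v (\<lambda>x. f (g x)) u = (\<Sum>b\<in>Basis. (dir_deriv v g u \<bullet> b) *\<^sub>R dir_deriv b f (g u))"
proof -
  have d: "(f has_derivative (\<lambda>v. dir_deriv v f (g u))) (at (g u))"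
    using has_derivative_dir_deriv[OF assms(2)] .
  then have lin: "linear (\<lambda>v. dir_deriv v f (g u))"
    using has_derivative_linear by blast
  have "dir_deriv v (\<lambda>x. f (g x)) u = dir_deriv (dir_deriv v g u) f (g u)"
    by (rule dir_deriv_eq) (rule has_derivative_compose[OF has_derivative_dir_deriv[OF assms(1)] d])
  also have "\<dots> = dir_deriv (\<Sum>b\<in>Basis. (dir_deriv v g u \<bullet> b) *\<^sub>R b) f (g u)"
    by (simp add: euclidean_representation)
  also have "\<dots> = (\<Sum>b\<in>Basis. (dir_deriv v g u \<bullet> b) *\<^sub>R dir_deriv b f (g u))"
    using linear_sum[OF lin, of "\<lambda>b. (dir_deriv v g u \<bullet> b) *\<^sub>R b" Basis] linear_cmul[OF lin] by simp
  finally show ?thesis .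
qed

lemma C_k_on_compose:
  fixes f :: "'b::euclidean_space \<Rightarrow> 'c::real_normed_vector" and g :: "'a::real_normed_vector \<Rightarrow> 'b"
  assumes S: "open S" and gT: "\<And>x. x \<in> S \<Longrightarrow> g x \<in> T" and "C_k_on k S g" "C_k_on k T f"
  shows "C_k_on k S (\<lambda>x. f (g x))"
  using assms(3,4)
proof (induction k arbitrary: f)
  case 0
  then show ?case using continuous_on_compose2[of T f S g] gT by auto
next
  case (Suc k)
  have inner: "C_k_on k S (\<lambda>x. dir_deriv v g x \<bullet> b)" for v b
    using Suc.prems by (intro C_k_on_bilinear[OF S bounded_bilinear_inner _ C_k_on_const]) (simp add: C_k_on_Suc_iff)
  have "C_k_on k S (\<lambda>x. dir_deriv b f (g x))" for b
    using Suc.prems by (intro Suc.IH) (auto simp: C_k_on_Suc_iff[of k T f] C_k_on_decrease)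
  then have "C_k_on k S (\<lambda>x. \<Sum>b\<in>Basis. (dir_deriv v g x \<bullet> b) *\<^sub>R dir_deriv b f (g x))" for v
    by (intro C_k_on_sum S C_k_on_bilinear[OF S bounded_bilinear_scaleR] inner)
  then have "C_k_on k S (dir_deriv v (\<lambda>x. f (g x)))" for v
    by (rule C_k_on_cong[OF S, rotated]) (use Suc.prems gT in \<open>simp add: C_k_on_Suc_iff dir_deriv_compose\<close>)
  moreover have "(\<lambda>x. f (g x)) differentiable at u" if "u \<in> S" for u
    using has_derivative_compose[OF has_derivative_dir_deriv has_derivative_dir_deriv, of g u f]
      Suc.prems gT that unfolding C_k_on_Suc_iff differentiable_def by blast
  ultimately show ?case by (simp add: C_k_on_Suc_iff)
qed

lemma smooth_on_dir_deriv: "smooth_on S f \<Longrightarrow> smooth_on S (dir_deriv v f)"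
  by (metis C_k_on_Suc_iff smooth_on_def)

lemma smooth_on_differentiable: "smooth_on S f \<Longrightarrow> u \<in> S \<Longrightarrow> f differentiable (at u)"
  by (metis C_k_on_Suc_iff smooth_on_def)

lemma smooth_on_continuous: "smooth_on S f \<Longrightarrow> continuous_on S f"
  by (metis C_k_on.simps(1) smooth_on_def)

lemma smooth_on_cong:
  "open S \<Longrightarrow> (\<And>x. x \<in> S \<Longrightarrow> f x = g x) \<Longrightarrow> smooth_on S f \<Longrightarrow> smooth_on S g"
  unfolding smooth_on_def using C_k_on_cong by blast

lemma smooth_on_local:
  "(\<And>u. u \<in> S \<Longrightarrow> \<exists>T. open T \<and> u \<in> T \<and> smooth_on T f) \<Longrightarrow> smooth_on S f"
  unfolding smooth_on_def by (meson C_k_on_local)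

lemma smooth_on_subset: "smooth_on S f \<Longrightarrow> T \<subseteq> S \<Longrightarrow> smooth_on T f"
  unfolding smooth_on_def using C_k_on_subset by blast

lemma smooth_on_const: "smooth_on S (\<lambda>x. c)"
  by (simp add: smooth_on_def C_k_on_const)

lemma smooth_on_linear: "bounded_linear f \<Longrightarrow> smooth_on S f"
  by (simp add: smooth_on_def C_k_on_linear)

lemma smooth_on_bilinear:
  "bounded_bilinear h \<Longrightarrow> open S \<Longrightarrow> smooth_on S f \<Longrightarrow> smooth_on S g \<Longrightarrow> smooth_on S (\<lambda>x. h (f x) (g x))"
  by (simp add: smooth_on_def C_k_on_bilinear)

lemmas smooth_on_inner = smooth_on_bilinear[OF bounded_bilinear_inner]
lemmas smooth_on_mult = smooth_on_bilinear[OF bounded_bilinear_mult]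
lemmas smooth_on_scaleR = smooth_on_bilinear[OF bounded_bilinear_scaleR]

lemma smooth_on_add: "open S \<Longrightarrow> smooth_on S f \<Longrightarrow> smooth_on S g \<Longrightarrow> smooth_on S (\<lambda>x. f x + g x)"
  by (simp add: smooth_on_def C_k_on_add)

lemma smooth_on_diff:
  assumes "open S" "smooth_on S f" "smooth_on S g"
  shows "smooth_on S (\<lambda>x. f x - g x)"
  using smooth_on_add[OF assms(1,2) smooth_on_scaleR[OF assms(1) smooth_on_const assms(3), of "-1"]] by simp

lemma smooth_on_compose:
  fixes f :: "'b::euclidean_space \<Rightarrow> 'c::real_normed_vector" and g :: "'a::real_normed_vector \<Rightarrow> 'b"
  assumes "open S" "smooth_on S g" "smooth_on T f" "\<And>x. x \<in> S \<Longrightarrow> g x \<in> T"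
  shows "smooth_on S (\<lambda>x. f (g x))"
  using assms by (simp add: smooth_on_def C_k_on_compose[where T=T])

lemma smooth_on_id: "smooth_on S (\<lambda>x. x)"
  by (rule smooth_on_linear) (rule bounded_linear_ident)

text \<open>
  A real function that solves a differential equation \<open>r' = c r\<^sup>m\<close> is smooth: each derivative is
  a polynomial in \<open>r\<close>. This covers \<open>1/x\<close> and \<open>1/\<surd>x\<close>.
\<close>

lemma smooth_on_ODE:
  fixes r :: "real \<Rightarrow> real"
  assumes S: "open S" and d: "\<And>x. x \<in> S \<Longrightarrow> (r has_real_derivative c * r x ^ m) (at x)"
  shows "smooth_on S r"
proof -
  have "C_k_on k S r" for k
  proof (induction k)
    case 0
    then show ?case using d by (auto intro!: continuous_at_imp_continuous_on DERIV_isCont)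
  next
    case (Suc k)
    have pow: "C_k_on k S (\<lambda>x. r x ^ j)" for j
      by (induction j) (auto intro: C_k_on_const C_k_on_bilinear[OF S bounded_bilinear_mult Suc])
    have "C_k_on k S (\<lambda>x. (c * r x ^ m) * v)" for v
      by (intro C_k_on_bilinear[OF S bounded_bilinear_mult] pow C_k_on_const)
    then have "C_k_on k S (dir_deriv v r)" for v
      by (rule C_k_on_cong[OF S, rotated])
        (rule dir_deriv_eq[symmetric], rule has_field_derivative_imp_has_derivative[OF d], assumption)
    then show ?case using d
      unfolding C_k_on_Suc_iff differentiable_def has_field_derivative_def by blast
  qed
  then show ?thesis by (simp add: smooth_on_def)
qed

lemma smooth_on_inverse:
  fixes f :: "'a::real_normed_vector \<Rightarrow> real"
  assumes "open S" "smooth_on S f" "\<And>x. x \<in> S \<Longrightarrow> f x > 0"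
  shows "smooth_on S (\<lambda>x. inverse (f x))"
proof (rule smooth_on_compose[OF assms(1,2), of "{0<..}"])
  show "smooth_on {0<..} (inverse :: real \<Rightarrow> real)"
    by (rule smooth_on_ODE[where c="-1" and m=2])
      (auto intro!: derivative_eq_intros simp: power2_eq_square)
qed (simp add: assms(3))

lemma inverse_sqrt_has_derivative:
  "x > 0 \<Longrightarrow> ((\<lambda>x. inverse (sqrt x)) has_real_derivative (-1/2) * inverse (sqrt x) ^ 3) (at x)"
  by (auto intro!: derivative_eq_intros simp: power2_eq_square power3_eq_cube field_simps)

lemma smooth_on_inverse_sqrt:
  fixes f :: "'a::real_normed_vector \<Rightarrow> real"
  assumes "open S" "smooth_on S f" "\<And>x. x \<in> S \<Longrightarrow> f x > 0"
  shows "smooth_on S (\<lambda>x. inverse (sqrt (f x)))"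
proof (rule smooth_on_compose[OF assms(1,2), of "{0<..}"])
  show "smooth_on {0<..} (\<lambda>x. inverse (sqrt x))"
    by (rule smooth_on_ODE[OF _ inverse_sqrt_has_derivative]) auto
qed (simp add: assms(3))

lemma line_has_derivative:
  assumes "f differentiable (at (u + s *\<^sub>R v))"
  shows "((\<lambda>s. f (u + s *\<^sub>R v)) has_vector_derivative dir_deriv v f (u + s *\<^sub>R v)) (at s)"
proof -
  have 1: "((\<lambda>s. u + s *\<^sub>R v) has_derivative (\<lambda>h. h *\<^sub>R v)) (at s)"
    by (auto intro!: derivative_eq_intros)
  have d: "(f has_derivative (\<lambda>h. dir_deriv h f (u + s *\<^sub>R v))) (at (u + s *\<^sub>R v))"
    by (rule has_derivative_dir_deriv[OF assms])
  show ?thesis unfolding has_vector_derivative_def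
    using has_derivative_compose[OF 1 d] linear_cmul[OF has_derivative_linear[OF d]]
    by simp
qed

text \<open>
  Two applications of the mean value theorem to the second difference of \<open>f\<close> over a small
  parallelogram express it by an interior value of the mixed derivative.
\<close>

lemma second_difference_mean_value:
  fixes f :: "'a::real_normed_vector \<Rightarrow> real"
  assumes S: "\<And>a b. 0 \<le> a \<Longrightarrow> a \<le> s \<Longrightarrow> 0 \<le> b \<Longrightarrow> b \<le> s \<Longrightarrow> u + a *\<^sub>R v + b *\<^sub>R w \<in> S"
    and f: "C_k_on 2 S f" and s: "s > 0"
  shows "\<exists>a b. 0 < a \<and> a < s \<and> 0 < b \<and> b < s \<and>
    f (u + s *\<^sub>R v + s *\<^sub>R w) - f (u + s *\<^sub>R v) - f (u + s *\<^sub>R w) + f u =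
    s * s * dir_deriv w (dir_deriv v f) (u + a *\<^sub>R v + b *\<^sub>R w)"
proof -
  have df: "f differentiable (at x)" "dir_deriv v f differentiable (at x)" if "x \<in> S" for x
    using f that by (auto simp: numeral_2_eq_2 C_k_on_Suc_iff)
  define k where "k a = f (u + s *\<^sub>R w + a *\<^sub>R v) - f (u + a *\<^sub>R v)" for a
  have "(k has_real_derivative dir_deriv v f (u + s *\<^sub>R w + a *\<^sub>R v) - dir_deriv v f (u + a *\<^sub>R v)) (at a)"
    if "0 \<le> a" "a \<le> s" for a
  proof -
    have "u + s *\<^sub>R w + a *\<^sub>R v \<in> S" "u + a *\<^sub>R v \<in> S"
      using S[of a s] S[of a 0] that s by (auto simp: add_ac)
    then show ?thesis unfolding k_def has_real_derivative_iff_has_vector_derivative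
      by (intro has_vector_derivative_diff line_has_derivative df)
  qed
  from MVT2[OF s this] obtain a where a: "0 < a" "a < s" and
    1: "k s - k 0 = s * (dir_deriv v f (u + s *\<^sub>R w + a *\<^sub>R v) - dir_deriv v f (u + a *\<^sub>R v))" by auto
  have "((\<lambda>b. dir_deriv v f (u + a *\<^sub>R v + b *\<^sub>R w)) has_real_derivative
      dir_deriv w (dir_deriv v f) (u + a *\<^sub>R v + b *\<^sub>R w)) (at b)" if "0 \<le> b" "b \<le> s" for b
    unfolding has_real_derivative_iff_has_vector_derivative
    using a that by (intro line_has_derivative df S) auto
  from MVT2[OF s this] obtain b where b: "0 < b" "b < s" and
    2: "dir_deriv v f (u + a *\<^sub>R v + s *\<^sub>R w) - dir_deriv v f (u + a *\<^sub>R v) =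
      s * dir_deriv w (dir_deriv v f) (u + a *\<^sub>R v + b *\<^sub>R w)" by auto
  have "k s - k 0 = s * s * dir_deriv w (dir_deriv v f) (u + a *\<^sub>R v + b *\<^sub>R w)"
    using 1 2 by (simp add: add_ac)
  then show ?thesis using a b
    by (intro exI[of _ a] exI[of _ b]) (simp add: k_def add_ac algebra_simps)
qed

text \<open>
  Both mixed derivatives take equal values at points of arbitrarily small parallelograms at \<open>u\<close>,
  and both are continuous.
\<close>

lemma dir_deriv_commute_real:
  fixes f :: "'a::real_normed_vector \<Rightarrow> real"
  assumes "open S" "u \<in> S" "C_k_on 2 S f"
  shows "dir_deriv w (dir_deriv v f) u = dir_deriv v (dir_deriv w f) u"
proof -
  obtain e where e: "e > 0" "ball u e \<subseteq> S" using assms openE by blast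
  define c where "c = norm v + norm w + 1"
  have c: "c > 0" unfolding c_def by (smt (verit) norm_ge_zero)
  \<comment> \<open>The parallelograms with sides \<open>s n *\<^sub>R v\<close> and \<open>s n *\<^sub>R w\<close> stay in the ball: \<open>s n * c < e\<close>.\<close>
  define s where "s n = e / (c * 2) * inverse (real (Suc n))" for n
  have s0: "s n > 0" for n using e c by (simp add: s_def)
  have sc: "s n * c < e" for n
  proof -
    have "s n * c = e / 2 * inverse (real (Suc n))" using c by (simp add: s_def)
    also have "\<dots> \<le> e / 2 * 1" using e by (intro mult_left_mono) (auto simp: inverse_le_1_iff)
    also have "\<dots> < e" using e by simp
    finally show ?thesis .
  qed
  have bnd: "norm (a *\<^sub>R v + b *\<^sub>R w) \<le> r * c" if "0 \<le> a" "a \<le> r" "0 \<le> b" "b \<le> r" for a b r :: real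
  proof -
    have "norm (a *\<^sub>R v + b *\<^sub>R w) \<le> a * norm v + b * norm w"
      using that norm_triangle_ineq[of "a *\<^sub>R v" "b *\<^sub>R w"] by simp
    also have "\<dots> \<le> r * norm v + r * norm w"
      using that by (intro add_mono mult_right_mono) auto
    also have "\<dots> \<le> r * c" using that by (simp add: c_def algebra_simps)
    finally show ?thesis .
  qed
  have inS: "u + a *\<^sub>R v + b *\<^sub>R w \<in> S" if "0 \<le> a" "a \<le> s n" "0 \<le> b" "b \<le> s n" for a b n
  proof -
    have "norm (a *\<^sub>R v + b *\<^sub>R w) < e" using bnd[OF that] sc[of n] by simp
    then have "u + a *\<^sub>R v + b *\<^sub>R w \<in> ball u e"
      using norm_minus_cancel[of "a *\<^sub>R v + b *\<^sub>R w"] by (simp add: dist_norm algebra_simps)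
    then show ?thesis using e by auto
  qed
  have "\<exists>a b a' b'. 0 < a \<and> a < s n \<and> 0 < b \<and> b < s n \<and> 0 < a' \<and> a' < s n \<and> 0 < b' \<and> b' < s n \<and>
      dir_deriv w (dir_deriv v f) (u + a *\<^sub>R v + b *\<^sub>R w) =
      dir_deriv v (dir_deriv w f) (u + a' *\<^sub>R v + b' *\<^sub>R w)" for n
  proof -
    obtain a b where ab: "0 < a" "a < s n" "0 < b" "b < s n"
      "f (u + s n *\<^sub>R v + s n *\<^sub>R w) - f (u + s n *\<^sub>R v) - f (u + s n *\<^sub>R w) + f u =
       s n * s n * dir_deriv w (dir_deriv v f) (u + a *\<^sub>R v + b *\<^sub>R w)"
      using second_difference_mean_value[of "s n" u v w S f] inS s0 assms(3) by blast
    have inS': "u + a *\<^sub>R w + b *\<^sub>R v \<in> S" if "0 \<le> a" "a \<le> s n" "0 \<le> b" "b \<le> s n" for a b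
      using inS[of b n a] that by (simp add: add_ac)
    obtain b' a' where ab': "0 < a'" "a' < s n" "0 < b'" "b' < s n"
      "f (u + s n *\<^sub>R w + s n *\<^sub>R v) - f (u + s n *\<^sub>R w) - f (u + s n *\<^sub>R v) + f u =
       s n * s n * dir_deriv v (dir_deriv w f) (u + b' *\<^sub>R w + a' *\<^sub>R v)"
      using second_difference_mean_value[of "s n" u w v S f, OF inS' assms(3) s0] by blast
    have "s n * s n * dir_deriv w (dir_deriv v f) (u + a *\<^sub>R v + b *\<^sub>R w) =
          s n * s n * dir_deriv v (dir_deriv w f) (u + b' *\<^sub>R w + a' *\<^sub>R v)"
    proof -
      have "u + s n *\<^sub>R w + s n *\<^sub>R v = u + s n *\<^sub>R v + s n *\<^sub>R w" by (simp add: add_ac)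
      then have "f (u + s n *\<^sub>R w + s n *\<^sub>R v) = f (u + s n *\<^sub>R v + s n *\<^sub>R w)" by (rule arg_cong)
      then show ?thesis using ab(5) ab'(5) by linarith
    qed
    then have "dir_deriv w (dir_deriv v f) (u + a *\<^sub>R v + b *\<^sub>R w) =
          dir_deriv v (dir_deriv w f) (u + b' *\<^sub>R w + a' *\<^sub>R v)"
      using s0[of n] by simp
    then show ?thesis using ab(1-4) ab'(1-4)
      by (intro exI[of _ a] exI[of _ b] exI[of _ a'] exI[of _ b']) (simp add: add_ac)
  qed
  then obtain a b a' b' where
    ab: "\<And>n. 0 < a n \<and> a n < s n \<and> 0 < b n \<and> b n < s n \<and> 0 < a' n \<and> a' n < s n \<and> 0 < b' n \<and> b' n < s n"
    and eq: "\<And>n. dir_deriv w (dir_deriv v f) (u + a n *\<^sub>R v + b n *\<^sub>R w) =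
      dir_deriv v (dir_deriv w f) (u + a' n *\<^sub>R v + b' n *\<^sub>R w)" by metis
  have slim: "s \<longlonglongrightarrow> 0"
    unfolding s_def using tendsto_mult[OF tendsto_const[of "e / (c * 2)"] LIMSEQ_inverse_real_of_nat] by simp
  have lim: "(\<lambda>n. u + a n *\<^sub>R v + b n *\<^sub>R w) \<longlonglongrightarrow> u"
    if "\<And>n. 0 < a n \<and> a n < s n \<and> 0 < b n \<and> b n < s n" for a b
  proof -
    have "a \<longlonglongrightarrow> 0" "b \<longlonglongrightarrow> 0"
      using that by (auto intro!: tendsto_sandwich[OF _ _ tendsto_const slim] always_eventually less_imp_le)
    then have "(\<lambda>n. u + a n *\<^sub>R v + b n *\<^sub>R w) \<longlonglongrightarrow> u + 0 *\<^sub>R v + 0 *\<^sub>R w"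
      by (intro tendsto_intros)
    then show ?thesis by simp
  qed
  have cont: "isCont (dir_deriv w (dir_deriv v f)) u" "isCont (dir_deriv v (dir_deriv w f)) u"
    using assms by (auto simp: numeral_2_eq_2 C_k_on_Suc_iff continuous_on_eq_continuous_at)
  have "(\<lambda>n. dir_deriv w (dir_deriv v f) (u + a n *\<^sub>R v + b n *\<^sub>R w)) \<longlonglongrightarrow> dir_deriv w (dir_deriv v f) u"
    by (rule isCont_tendsto_compose[OF cont(1) lim]) (use ab in blast)
  moreover have "(\<lambda>n. dir_deriv v (dir_deriv w f) (u + a' n *\<^sub>R v + b' n *\<^sub>R w)) \<longlonglongrightarrow> dir_deriv v (dir_deriv w f) u"
    by (rule isCont_tendsto_compose[OF cont(2) lim]) (use ab in blast)
  ultimately show ?thesis using LIMSEQ_unique unfolding eq by blast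
qed

lemma dir_deriv_inner:
  assumes "f differentiable (at u)" "g differentiable (at u)"
  shows "dir_deriv v (\<lambda>x. f x \<bullet> g x) u = f u \<bullet> dir_deriv v g u + dir_deriv v f u \<bullet> g u"
  by (rule dir_deriv_bilinear[OF bounded_bilinear_inner assms])

lemma dir_deriv_mult:
  fixes f g :: "'a::real_normed_vector \<Rightarrow> real"
  assumes "f differentiable (at u)" "g differentiable (at u)"
  shows "dir_deriv v (\<lambda>x. f x * g x) u = f u * dir_deriv v g u + dir_deriv v f u * g u"
  by (rule dir_deriv_bilinear[OF bounded_bilinear_mult assms])

lemma dir_deriv_scaleR:
  assumes "f differentiable (at u)" "g differentiable (at u)"
  shows "dir_deriv v (\<lambda>x. f x *\<^sub>R g x) u = f u *\<^sub>R dir_deriv v g u + dir_deriv v f u *\<^sub>R g u"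
  by (rule dir_deriv_bilinear[OF bounded_bilinear_scaleR assms])

lemma dir_deriv_const [simp]: "dir_deriv v (\<lambda>x. c) u = 0"
  by (rule dir_deriv_eq) simp

lemma dir_deriv_diff:
  assumes "f differentiable (at u)" "g differentiable (at u)"
  shows "dir_deriv v (\<lambda>x. f x - g x) u = dir_deriv v f u - dir_deriv v g u"
  by (rule dir_deriv_eq[THEN trans],
      rule has_derivative_diff[OF has_derivative_dir_deriv[OF assms(1)] has_derivative_dir_deriv[OF assms(2)]]) simp

lemma dir_deriv_commute:
  fixes f :: "'a::real_normed_vector \<Rightarrow> 'b::euclidean_space"
  assumes S: "open S" "u \<in> S" and f: "smooth_on S f"
  shows "dir_deriv w (dir_deriv v f) u = dir_deriv v (dir_deriv w f) u"
proof (rule euclidean_eqI)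
  fix b :: 'b assume "b \<in> Basis"
  have d: "f differentiable at x" "dir_deriv v f differentiable at x" if "x \<in> S" for v x
    using f that smooth_on_dir_deriv smooth_on_differentiable by blast+
  have 1: "dir_deriv v (\<lambda>x. f x \<bullet> b) x = dir_deriv v f x \<bullet> b" if "x \<in> S" for v x
    using dir_deriv_inner[OF d(1)[OF that], of "\<lambda>x. b"] by simp
  have 2: "dir_deriv w (dir_deriv v (\<lambda>x. f x \<bullet> b)) u = dir_deriv w (dir_deriv v f) u \<bullet> b" for v w
    using dir_deriv_cong[OF S 1, where v=w] dir_deriv_inner[OF d(2)[OF S(2)], of "\<lambda>x. b"] by simp
  have "C_k_on 2 S (\<lambda>x. f x \<bullet> b)"
    using smooth_on_inner[OF S(1) f smooth_on_const] by (simp add: smooth_on_def)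
  from dir_deriv_commute_real[OF S this, of w v]
  show "dir_deriv w (dir_deriv v f) u \<bullet> b = dir_deriv v (dir_deriv w f) u \<bullet> b" by (simp add: 2)
qed


section \<open>Bump functions and integration by parts\<close>

text \<open>
  The case \<open>n = 0\<close> is the classical function \<open>exp (- 1/x)\<close>. The powers of \<open>1/x\<close> are included because
  the derivatives of these functions are linear combinations of functions of the same kind.
\<close>

definition flat :: "nat \<Rightarrow> real \<Rightarrow> real" where
  "flat n x = (if x > 0 then inverse x ^ n * exp (- inverse x) else 0)"

lemma flat_tendsto_0: "(flat n \<longlongrightarrow> 0) (at_right 0)"
proof -
  have "((\<lambda>x. inverse x ^ n / exp (inverse x)) \<longlongrightarrow> 0) (at_right (0::real))"
    by (rule filterlim_compose[OF tendsto_power_div_exp_0 filterlim_inverse_at_top_right])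
  moreover have "\<forall>\<^sub>F x in at_right (0::real). inverse x ^ n / exp (inverse x) = flat n x"
    unfolding eventually_at_right_field by (auto simp: flat_def exp_minus divide_inverse intro: exI[of _ 1])
  ultimately show ?thesis by (rule Lim_transform_eventually)
qed

text \<open>
  The point \<open>x = 0\<close> needs the limit of the difference quotient, which from the right is
  \<open>flat (Suc n)\<close> itself.
\<close>

lemma flat_has_derivative:
  "(flat n has_real_derivative (flat (n + 2) x - real n * flat (Suc n) x)) (at x)"
proof -
  consider "x > 0" | "x < 0" | "x = 0" by linarith
  then show ?thesis
  proof cases
    case 1
    have "((\<lambda>x. inverse x ^ n * exp (- inverse x)) has_real_derivative
        (flat (n + 2) x - real n * flat (Suc n) x)) (at x)"
    proof (cases n)
      case 0
      then show ?thesis using 1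
        by (auto intro!: derivative_eq_intros simp: flat_def power2_eq_square)
    next
      case (Suc m)
      have "inverse x ^ m = inverse x * inverse x ^ (m - Suc 0)" if "m \<noteq> 0"
        using that by (cases m) auto
      then show ?thesis using 1 Suc
        by (cases "m = 0") (auto intro!: derivative_eq_intros simp: flat_def power2_eq_square algebra_simps)
    qed
    then show ?thesis
      by (rule has_field_derivative_transform_within_open[of _ _ _ "{0<..}"])
        (use 1 in \<open>auto simp: flat_def\<close>)
  next
    case 2
    have "((\<lambda>x. 0) has_real_derivative (flat (n + 2) x - real n * flat (Suc n) x)) (at x)"
      using 2 by (simp add: flat_def)
    then show ?thesis
      by (rule has_field_derivative_transform_within_open[of _ _ _ "{..<0}"])
        (use 2 in \<open>auto simp: flat_def\<close>)
  next
    case 3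
    have l: "((\<lambda>h. flat n h / h) \<longlongrightarrow> 0) (at_left 0)"
      by (rule Lim_transform_eventually[OF tendsto_const])
        (auto simp: eventually_at_left_field flat_def intro!: exI[of _ "-1"])
    have r: "((\<lambda>h. flat n h / h) \<longlongrightarrow> 0) (at_right 0)"
      by (rule Lim_transform_eventually[OF flat_tendsto_0[of "Suc n"]])
        (auto simp: eventually_at_right_field flat_def divide_inverse intro!: exI[of _ "1"])
    show ?thesis
      using filterlim_split_at[OF l r] by (simp add: 3 has_field_derivative_iff flat_def)
  qed
qed

lemma smooth_on_flat: "smooth_on S (flat n)"
proof -
  have "C_k_on k UNIV (flat n)" for k n
  proof (induction k arbitrary: n)
    case 0
    then show ?case using DERIV_isCont[OF flat_has_derivative]
      by (auto intro!: continuous_at_imp_continuous_on)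
  next
    case (Suc k)
    have "C_k_on k UNIV (\<lambda>x. (flat (n + 2) x + (- real n) * flat (Suc n) x) * v)" for v
      by (intro C_k_on_add C_k_on_bilinear[OF _ bounded_bilinear_mult] C_k_on_const Suc open_UNIV)
    moreover have "dir_deriv v (flat n) = (\<lambda>x. (flat (n + 2) x + (- real n) * flat (Suc n) x) * v)" for v
      using dir_deriv_eq[OF has_field_derivative_imp_has_derivative[OF flat_has_derivative[of n]]]
      by auto
    ultimately show ?case using flat_has_derivative
      unfolding C_k_on_Suc_iff differentiable_def has_field_derivative_def by metis
  qed
  then show ?thesis unfolding smooth_on_def using C_k_on_subset by blast
qed

text \<open>
  For \<open>r \<ge> 0\<close> it is smooth and positive exactly on the open ball of radius \<open>r\<close> around \<open>p\<close>; the squared distance keeps it smooth at \<open>p\<close>.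
\<close>

definition bump :: "'a::euclidean_space \<Rightarrow> real \<Rightarrow> 'a \<Rightarrow> real" where
  "bump p r u = flat 0 (r\<^sup>2 - (u - p) \<bullet> (u - p))"

lemma smooth_on_bump: "open S \<Longrightarrow> smooth_on S (bump p r)"
  unfolding bump_def[abs_def]
  by (rule smooth_on_compose[OF _ _ smooth_on_flat[of UNIV]])
    (auto intro!: smooth_on_diff smooth_on_inner smooth_on_id smooth_on_const)

lemma bump_nonneg: "bump p r u \<ge> 0"
  by (simp add: bump_def flat_def)

lemma bump_pos: "norm (u - p) < r \<Longrightarrow> bump p r u > 0"
proof -
  assume "norm (u - p) < r"
  then have "(norm (u - p))\<^sup>2 < r\<^sup>2" by (intro power_strict_mono) auto
  then show ?thesis by (simp add: bump_def flat_def dot_square_norm)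
qed

lemma bump_eq_0: "r \<ge> 0 \<Longrightarrow> r \<le> norm (u - p) \<Longrightarrow> bump p r u = 0"
proof -
  assume "r \<ge> 0" "r \<le> norm (u - p)"
  then have "r\<^sup>2 \<le> (norm (u - p))\<^sup>2" by (intro power_mono) auto
  then show ?thesis by (simp add: bump_def flat_def dot_square_norm)
qed

text \<open>
  The integral of \<open>f\<close> translated by \<open>t v\<close> does not depend on \<open>t\<close>; its derivative at \<open>0\<close>
  is the integral of the directional derivative.
\<close>

lemma integral_dir_deriv_eq_0:
  fixes f :: "'a::euclidean_space \<Rightarrow> real"
  assumes d: "\<And>u. f differentiable (at u)" and c: "continuous_on UNIV (dir_deriv v f)"
    and z: "\<And>u. u \<notin> cbox a b \<Longrightarrow> f u = 0"
  shows "integral (cbox a b) (dir_deriv v f) = 0"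
proof -
  \<comment> \<open>The larger box contains the support of every translate by \<open>t *\<^sub>R v\<close> with \<open>\<bar>t\<bar> \<le> 1\<close>.\<close>
  define a' b' where "a' = a - norm v *\<^sub>R One" and "b' = b + norm v *\<^sub>R One"
  have cont: "continuous_on S f" for S
    using d by (auto intro!: continuous_at_imp_continuous_on differentiable_imp_continuous_within)
  have sub: "cbox a b \<subseteq> cbox (a' + t *\<^sub>R v) (b' + t *\<^sub>R v)" if "\<bar>t\<bar> \<le> 1" for t
  proof
    fix u assume u: "u \<in> cbox a b"
    have "\<bar>(t *\<^sub>R v) \<bullet> i\<bar> \<le> norm v" if i: "i \<in> Basis" for i
    proof -
      have "\<bar>(t *\<^sub>R v) \<bullet> i\<bar> = \<bar>t\<bar> * \<bar>v \<bullet> i\<bar>" by (simp add: abs_mult)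
      also have "\<dots> \<le> 1 * norm v" using \<open>\<bar>t\<bar> \<le> 1\<close> Basis_le_norm[OF i] by (intro mult_mono) auto
      finally show ?thesis by simp
    qed
    then show "u \<in> cbox (a' + t *\<^sub>R v) (b' + t *\<^sub>R v)"
      using u unfolding mem_box a'_def b'_def by (force simp: inner_simps abs_le_iff)
  qed
  define g where "g t = integral (cbox a' b') (\<lambda>x. f (x + t *\<^sub>R v))" for t
  have g: "g t = integral (cbox a b) f" if "\<bar>t\<bar> \<le> 1" for t
  proof -
    have "(f has_integral integral (cbox a b) f) (cbox a b)"
      by (intro integrable_integral integrable_continuous cont)
    then have "(f has_integral integral (cbox a b) f) (cbox (a' + t *\<^sub>R v) (b' + t *\<^sub>R v))"
      by (rule has_integral_on_superset[OF _ _ sub[OF that]]) (use z in auto)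
    then show ?thesis unfolding g_def
      using integral_shift_cbox_plus[of a' b' f "t *\<^sub>R v"]
      by (simp add: integral_unique comp_def add.commute)
  qed
  have "(g has_real_derivative integral (cbox a' b') (\<lambda>x. dir_deriv v f (x + 0 *\<^sub>R v))) (at 0 within {-1<..<1})"
    unfolding g_def
  proof (rule leibniz_rule_field_derivative[where f="\<lambda>t x. f (x + t *\<^sub>R v)" and fx="\<lambda>t x. dir_deriv v f (x + t *\<^sub>R v)"])
    fix t x assume "t \<in> {-1<..<1::real}"
    show "((\<lambda>t. f (x + t *\<^sub>R v)) has_real_derivative dir_deriv v f (x + t *\<^sub>R v)) (at t within {-1<..<1})"
      using has_vector_derivative_at_within[OF line_has_derivative[OF d]]
      unfolding has_real_derivative_iff_has_vector_derivative .
  next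
    show "(\<lambda>x. f (x + t *\<^sub>R v)) integrable_on cbox a' b'" for t
      by (intro integrable_continuous continuous_on_compose2[OF cont[of UNIV]] continuous_intros) auto
    show "continuous_on ({-1<..<1} \<times> cbox a' b') (\<lambda>(t, x). dir_deriv v f (x + t *\<^sub>R v))"
      unfolding split_beta by (intro continuous_on_compose2[OF c] continuous_intros) auto
  qed auto
  then have 1: "(g has_real_derivative integral (cbox a' b') (dir_deriv v f)) (at 0)"
    by (simp add: at_within_open[of 0 "{-1<..<1}"])
  have "(g has_real_derivative 0) (at 0)"
    by (rule has_field_derivative_transform_within_open[of "\<lambda>_. integral (cbox a b) f" _ _ "{-1<..<1}"])
      (auto simp: g)
  with 1 have 0: "integral (cbox a' b') (dir_deriv v f) = 0" using DERIV_unique by blast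
  have d0: "dir_deriv v f u = 0" if "u \<notin> cbox a b" for u
    using dir_deriv_cong[of "- cbox a b" u f "\<lambda>_. 0" v] that z by (simp add: open_Compl closed_cbox)
  have "(dir_deriv v f has_integral integral (cbox a b) (dir_deriv v f)) (cbox a b)"
    by (intro integrable_integral integrable_continuous continuous_on_subset[OF c]) auto
  then have "(dir_deriv v f has_integral integral (cbox a b) (dir_deriv v f)) (cbox a' b')"
    by (rule has_integral_on_superset) (use d0 sub[of 0] in auto)
  with 0 show ?thesis by (simp add: integral_unique)
qed


section \<open>The Dirichlet energy in a chart\<close>

definition first_form :: "('a::real_normed_vector \<Rightarrow> 'b::real_inner) \<Rightarrow> 'a \<Rightarrow> 'a \<Rightarrow> 'a \<Rightarrow> real" where
  "first_form X v w u = dir_deriv v X u \<bullet> dir_deriv w X u"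

definition gram_det :: "('a::real_normed_vector \<Rightarrow> 'b::real_inner) \<Rightarrow> 'a \<Rightarrow> 'a \<Rightarrow> 'a \<Rightarrow> real" where
  "gram_det X v w u = first_form X v v u * first_form X w w u - (first_form X v w u)\<^sup>2"

text \<open>
  In a chart with coordinate vectors \<open>v\<close>, \<open>w\<close> this is \<open>gram_det\<close> times the inner product of
  \<open>dA\<close> and \<open>dB\<close>; the factor clears the denominators of the inverse metric.
\<close>

definition dirichlet_form ::
  "('a::real_normed_vector \<Rightarrow> 'b::real_inner) \<Rightarrow> 'a \<Rightarrow> 'a \<Rightarrow> ('a \<Rightarrow> 'c::real_inner) \<Rightarrow> ('a \<Rightarrow> 'c) \<Rightarrow> 'a \<Rightarrow> real" where
  "dirichlet_form X v w A B u =
     first_form X w w u * (dir_deriv v A u \<bullet> dir_deriv v B u)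
   - first_form X v w u * (dir_deriv v A u \<bullet> dir_deriv w B u + dir_deriv w A u \<bullet> dir_deriv v B u)
   + first_form X v v u * (dir_deriv w A u \<bullet> dir_deriv w B u)"

abbreviation "e1 \<equiv> axis 1 1 :: real^2"
abbreviation "e2 \<equiv> axis 2 1 :: real^2"

lemma matrix_inv_2:
  fixes A :: "real^2^2"
  assumes "det A \<noteq> 0"
  shows "matrix_inv A $ 1 $ 1 = A$2$2 / det A" "matrix_inv A $ 1 $ 2 = - A$1$2 / det A"
    "matrix_inv A $ 2 $ 1 = - A$2$1 / det A" "matrix_inv A $ 2 $ 2 = A$1$1 / det A"
proof -
  define d where "d = det A"
  have d: "d \<noteq> 0" "A$1$1 * A$2$2 = d + A$1$2 * A$2$1" using assms by (auto simp: d_def det_2)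
  define B :: "real^2^2" where
    "B = (\<chi> i j. if i = 1 then (if j = 1 then A$2$2 else - A$1$2) / d
                 else (if j = 1 then - A$2$1 else A$1$1) / d)"
  have AB: "A ** B = mat 1" and BA: "B ** A = mat 1"
    using d(1) by (simp_all add: vec_eq_iff forall_2 matrix_matrix_mult_def sum_2 mat_def B_def
        diff_divide_distrib[symmetric] mult.commute d(2))
  have "matrix_inv A = B"
    unfolding matrix_inv_def
  proof (rule some_equality)
    show "A' = B" if "A ** A' = mat 1 \<and> A' ** A = mat 1" for A'
      by (metis AB matrix_mul_assoc matrix_mul_lid matrix_mul_rid that)
  qed (simp add: AB BA)
  then show "matrix_inv A $ 1 $ 1 = A$2$2 / det A" "matrix_inv A $ 1 $ 2 = - A$1$2 / det A"
    "matrix_inv A $ 2 $ 1 = - A$2$1 / det A" "matrix_inv A $ 2 $ 2 = A$1$1 / det A"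
    by (simp_all add: B_def d_def)
qed

lemma gram_det_nonneg: "gram_det X v w u \<ge> 0"
  using Cauchy_Schwarz_ineq[of "dir_deriv v X u" "dir_deriv w X u"] by (simp add: gram_det_def first_form_def)

text \<open>
  Equality in the Cauchy--Schwarz inequality would make the images of \<open>v\<close> and \<open>w\<close> dependent; the
  relation \<open>?z = 0\<close> below is the explicit dependence.
\<close>

lemma gram_det_pos:
  assumes d: "X differentiable (at u)" and inj: "inj (\<lambda>v. dir_deriv v X u)"
    and ind: "\<And>a b. a *\<^sub>R v + b *\<^sub>R w = 0 \<Longrightarrow> a = 0 \<and> b = 0"
  shows "gram_det X v w u > 0"
proof (rule ccontr)
  assume "\<not> ?thesis"
  then have 0: "gram_det X v w u = 0" using gram_det_nonneg[of X v w u] by linarith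
  have lin: "linear (\<lambda>v. dir_deriv v X u)" using has_derivative_linear[OF has_derivative_dir_deriv[OF d]] .
  define p q where "p = dir_deriv v X u" and "q = dir_deriv w X u"
  let ?z = "(q \<bullet> q) *\<^sub>R p - (p \<bullet> q) *\<^sub>R q"
  have "?z \<bullet> ?z = (q \<bullet> q) * gram_det X v w u"
    by (simp add: gram_det_def first_form_def p_def[symmetric] q_def[symmetric] inner_simps
        power2_eq_square inner_commute algebra_simps)
  with 0 have "?z = 0" by simp
  moreover have "dir_deriv ((q \<bullet> q) *\<^sub>R v - (p \<bullet> q) *\<^sub>R w) X u = ?z"
    using linear_diff[OF lin] linear_cmul[OF lin] by (simp add: p_def q_def)
  ultimately have "dir_deriv ((q \<bullet> q) *\<^sub>R v - (p \<bullet> q) *\<^sub>R w) X u = dir_deriv 0 X u"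
    using linear_0[OF lin] by simp
  then have "(q \<bullet> q) *\<^sub>R v + (- (p \<bullet> q)) *\<^sub>R w = 0" using injD[OF inj] by fastforce
  then have "q = 0" using ind by fastforce
  then have "dir_deriv w X u = dir_deriv 0 X u" using linear_0[OF lin] by (simp add: q_def)
  then have "w = 0" using injD[OF inj] by blast
  then show False using ind[of 0 1] by simp
qed

lemma axis_independent: "a *\<^sub>R e1 + b *\<^sub>R e2 = 0 \<Longrightarrow> a = 0 \<and> b = 0"
  by (auto simp: vec_eq_iff forall_2 axis_def)

lemma chart_map_inv: "u \<in> chart_image c \<Longrightarrow> chart_map c (chart_inv c u) = u"
  unfolding chart_image_def chart_inv_def by (rule f_inv_into_f)

lemma chart_inv_in_dom: "u \<in> chart_image c \<Longrightarrow> chart_inv c u \<in> chart_dom c"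
  unfolding chart_image_def chart_inv_def by (rule inv_into_into)

lemma smooth_atlasD:
  assumes "smooth_atlas \<A>" "c \<in> \<A>"
  shows "open (chart_dom c)" "open (chart_image c)"
    "continuous_on (chart_dom c) (chart_map c)" "continuous_on (chart_image c) (chart_inv c)"
    "p \<in> chart_dom c \<Longrightarrow> chart_inv c (chart_map c p) = p"
    "p \<in> chart_dom c \<Longrightarrow> chart_map c p \<in> chart_image c"
  using assms unfolding smooth_atlas_def homeomorphism_def chart_image_def by auto

lemma chart_inv_image:
  assumes "smooth_atlas \<A>" "c \<in> \<A>" "W \<subseteq> chart_image c"
  shows "chart_inv c ` W = chart_dom c \<inter> chart_map c -` W"
proof (intro set_eqI iffI)
  fix p assume "p \<in> chart_inv c ` W"
  then obtain u where u: "u \<in> W" "p = chart_inv c u" by blast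
  with assms(3) have "u \<in> chart_image c" by blast
  with u show "p \<in> chart_dom c \<inter> chart_map c -` W" by (simp add: chart_inv_in_dom chart_map_inv)
next
  fix p assume "p \<in> chart_dom c \<inter> chart_map c -` W"
  with smooth_atlasD(5)[OF assms(1,2), of p] show "p \<in> chart_inv c ` W"
    by (intro image_eqI[of _ _ "chart_map c p"]) auto
qed

lemma chart_map_image:
  assumes "smooth_atlas \<A>" "c \<in> \<A>" "W \<subseteq> chart_dom c"
  shows "chart_map c ` W = chart_image c \<inter> chart_inv c -` W"
proof (intro set_eqI iffI)
  fix u assume "u \<in> chart_map c ` W"
  then obtain p where p: "p \<in> W" "u = chart_map c p" by blast
  with assms(3) have "p \<in> chart_dom c" by blast
  with p show "u \<in> chart_image c \<inter> chart_inv c -` W"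
    using smooth_atlasD(5,6)[OF assms(1,2), of p] by simp
next
  fix u assume "u \<in> chart_image c \<inter> chart_inv c -` W"
  with chart_map_inv[of u c] show "u \<in> chart_map c ` W"
    by (intro image_eqI[of _ _ "chart_inv c u"]) auto
qed

lemma gram_eq_first_form:
  assumes "u \<in> chart_image c"
  shows "gram c x (chart_inv c u) $ i $ j = first_form (local_rep c x) (axis i 1) (axis j 1) u"
  using chart_map_inv[OF assms] by (simp add: gram_def first_form_def differential_def dir_deriv_def)

lemma det_gram:
  assumes "u \<in> chart_image c"
  shows "det (gram c x (chart_inv c u)) = gram_det (local_rep c x) e1 e2 u"
  by (simp add: det_2 gram_eq_first_form[OF assms] gram_det_def power2_eq_square)
    (simp add: first_form_def inner_commute)

lemma gram_det_chart_pos: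
  assumes "smooth_atlas \<A>" "immersed_in_sphere \<A> x" "c \<in> \<A>" "u \<in> chart_image c"
    "\<And>a b. a *\<^sub>R v + b *\<^sub>R w = 0 \<Longrightarrow> a = 0 \<and> b = 0"
  shows "gram_det (local_rep c x) v w u > 0"
proof (rule gram_det_pos[OF _ _ assms(5)])
  show "local_rep c x differentiable at u"
    using assms by (auto simp: immersed_in_sphere_def smooth_map_def intro: smooth_on_differentiable)
  have "inj (differential c x (chart_inv c u))"
    using assms(2,3) chart_inv_in_dom[OF assms(4)] unfolding immersed_in_sphere_def by blast
  then show "inj (\<lambda>v. dir_deriv v (local_rep c x) u)"
    using chart_map_inv[OF assms(4)] by (simp add: differential_def dir_deriv_def[abs_def])
qed

text \<open>
  The inverse metric contributes \<open>1/g\<close> and the area element \<open>\<surd>g\<close>, which leaves the factor \<open>1/\<surd>g\<close>.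
\<close>

lemma energy_integrand_eq:
  assumes "u \<in> chart_image c" "gram_det (local_rep c x) e1 e2 u > 0"
  shows "energy_integrand c x f u =
    dirichlet_form (local_rep c x) e1 e2 (local_rep c f) (local_rep c f) u
      * inverse (sqrt (gram_det (local_rep c x) e1 e2 u))"
proof -
  define d where "d = gram_det (local_rep c x) e1 e2 u"
  have "d > 0" using assms by (simp add: d_def)
  then have s: "sqrt d = d * inverse (sqrt d)"
    by (simp add: field_simps flip: power2_eq_square)
  have "det (gram c x (chart_inv c u)) = d" using det_gram[OF assms(1)] by (simp add: d_def)
  then have "energy_integrand c x f u =
      dirichlet_form (local_rep c x) e1 e2 (local_rep c f) (local_rep c f) u / d * sqrt d"
    using \<open>d > 0\<close>
    by (simp add: energy_integrand_def energy_density_def sum_2 matrix_inv_2 gram_eq_first_form[OF assms(1)]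
        dirichlet_form_def differential_def chart_map_inv[OF assms(1)] dir_deriv_def[symmetric]
        inner_commute first_form_def add_divide_distrib diff_divide_distrib algebra_simps)
  also have "\<dots> = dirichlet_form (local_rep c x) e1 e2 (local_rep c f) (local_rep c f) u * inverse (sqrt d)"
    using s \<open>d > 0\<close> by (simp add: field_simps)
  finally show ?thesis by (simp add: d_def)
qed

lemma smooth_on_first_form:
  "open S \<Longrightarrow> smooth_on S X \<Longrightarrow> smooth_on S (first_form X v w)"
  unfolding first_form_def[abs_def] by (intro smooth_on_inner smooth_on_dir_deriv)

lemma smooth_on_gram_det:
  "open S \<Longrightarrow> smooth_on S X \<Longrightarrow> smooth_on S (gram_det X v w)"
  unfolding gram_det_def[abs_def] power2_eq_square by (intro smooth_on_diff smooth_on_mult smooth_on_first_form)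

section \<open>The first variation of the energy\<close>

text \<open>
  Boxes are the domains of variation: they are convex, so their interior is connected, and integrals over
  them can be differentiated in a parameter. Since the surface is Hausdorff, the closure and the
  interior of the image of a box in the surface are those computed in the chart.
\<close>

lemma chart_box_subdomain:
  fixes \<A> :: "'m::t2_space chart set"
  assumes at: "smooth_atlas \<A>" "c \<in> \<A>" and ab: "cbox a b \<subseteq> chart_image c" "box a b \<noteq> {}"
  shows "compact_subdomain (chart_inv c ` cbox a b)"
    "closed (chart_inv c ` cbox a b)" "chart_inv c ` cbox a b \<subseteq> chart_dom c"
    "chart_map c ` chart_inv c ` cbox a b = cbox a b"
proof -
  note c = smooth_atlasD[OF at]
  let ?D = "chart_inv c ` cbox a b"
  have cont: "continuous_on (cbox a b) (chart_inv c)" using c(4) ab continuous_on_subset by blast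
  then have comp: "compact ?D" by (rule compact_continuous_image) simp
  then show cl: "closed ?D" by (rule compact_imp_closed)
  show sub: "?D \<subseteq> chart_dom c" using chart_inv_in_dom ab by blast
  have "(\<lambda>u. chart_map c (chart_inv c u)) ` cbox a b = (\<lambda>u. u) ` cbox a b"
    by (rule image_cong[OF refl]) (use chart_map_inv ab in blast)
  then show im: "chart_map c ` ?D = cbox a b" by (simp add: image_image)
  have op: "open (chart_inv c ` W)" if "open W" "W \<subseteq> chart_image c" for W
    using continuous_open_preimage[OF c(3) c(1) that(1)] chart_inv_image[OF at that(2)] by simp
  have op': "open (chart_map c ` W)" if "open W" "W \<subseteq> chart_dom c" for W
    using continuous_open_preimage[OF c(4) c(2) that(1)] chart_map_image[OF at that(2)] by simp
  have bsub: "box a b \<subseteq> chart_image c" using ab box_subset_cbox by blast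
  have int: "interior ?D = chart_inv c ` box a b"
  proof (rule antisym)
    have sub': "interior ?D \<subseteq> chart_dom c" using interior_subset sub by (rule subset_trans)
    have "chart_map c ` interior ?D \<subseteq> cbox a b"
      using image_mono[OF interior_subset, of "chart_map c" ?D] im by simp
    then have "chart_map c ` interior ?D \<subseteq> interior (cbox a b)"
      using op'[OF open_interior sub'] by (rule interior_maximal)
    then have "chart_map c ` interior ?D \<subseteq> box a b" by (simp add: interior_cbox)
    then have "interior ?D \<subseteq> chart_dom c \<inter> chart_map c -` box a b"
      using sub' by (simp add: image_subset_iff_subset_vimage)
    then show "interior ?D \<subseteq> chart_inv c ` box a b" by (simp add: chart_inv_image[OF at bsub])
    show "chart_inv c ` box a b \<subseteq> interior ?D"
      using image_mono[OF box_subset_cbox] op[OF open_box bsub] by (rule interior_maximal)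
  qed
  have "?D \<subseteq> closure (interior ?D)"
  proof -
    have "chart_inv c ` closure (box a b) \<subseteq> closure (chart_inv c ` box a b)"
      using cont by (intro image_closure_subset) (auto simp: closure_box[OF ab(2)] closure_subset)
    then show ?thesis by (simp add: closure_box[OF ab(2)] int)
  qed
  moreover have "closure (interior ?D) \<subseteq> ?D"
    using closure_minimal[OF interior_subset cl] .
  moreover have "connected (interior ?D)"
    unfolding int using c(4) bsub
    by (intro connected_continuous_image) (auto intro: continuous_on_subset convex_connected)
  ultimately show "compact_subdomain ?D" using comp by (auto simp: compact_subdomain_def)
qed

text \<open>
  Every point has a neighbourhood on which the extended field is either \<open>Y\<close> composed with a smooth change of
  charts or identically zero, since the image of the box is closed.
\<close>

lemma smooth_map_extend_by_zero:
  fixes \<A> :: "'m::t2_space chart set" and Y :: "real^2 \<Rightarrow> 'b::real_normed_vector"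
  assumes at: "smooth_atlas \<A>" "c \<in> \<A>" and ab: "cbox a b \<subseteq> chart_image c" "box a b \<noteq> {}"
    and Y: "smooth_on (chart_image c) Y" "\<And>u. u \<in> chart_image c \<Longrightarrow> u \<notin> cbox a b \<Longrightarrow> Y u = 0"
  shows "smooth_map \<A> (\<lambda>p. if p \<in> chart_dom c then Y (chart_map c p) else 0)"
  unfolding smooth_map_def
proof
  let ?V = "\<lambda>p. if p \<in> chart_dom c then Y (chart_map c p) else 0"
  note c = smooth_atlasD[OF at]
  fix d assume d: "d \<in> \<A>"
  note dd = smooth_atlasD[OF at(1) d]
  show "smooth_on (chart_image d) (local_rep d ?V)"
  proof (rule smooth_on_local)
    fix u assume u: "u \<in> chart_image d"
    show "\<exists>T. open T \<and> u \<in> T \<and> smooth_on T (local_rep d ?V)"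
    \<comment> \<open>Away from the chart \<open>c\<close> the field vanishes near the point, because the image of the box is closed.\<close>
    proof (cases "chart_inv d u \<in> chart_dom c")
      case True
      define T where "T = chart_image d \<inter> chart_inv d -` chart_dom c"
      have T: "open T" unfolding T_def by (rule continuous_open_preimage[OF dd(4,2) c(1)])
      have "T = chart_map d ` (chart_dom d \<inter> chart_dom c)"
        using chart_inv_in_dom[of _ d] by (subst chart_map_image[OF at(1) d]) (auto simp: T_def simp del: split_paired_All)
      then have tr: "smooth_on T (\<lambda>u. chart_map c (chart_inv d u))"
        using at d by (simp add: smooth_atlas_def comp_def)
      have "smooth_on T (\<lambda>u. Y (chart_map c (chart_inv d u)))"
        by (rule smooth_on_compose[OF T tr Y(1)]) (auto simp: T_def c(6))
      then have "smooth_on T (local_rep d ?V)"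
        by (rule smooth_on_cong[OF T, rotated]) (simp add: local_rep_def T_def)
      with T True u show ?thesis by (auto simp: T_def)
    next
      case False
      define T where "T = chart_image d \<inter> chart_inv d -` (- chart_inv c ` cbox a b)"
      have T: "open T" unfolding T_def
        using chart_box_subdomain(2)[OF at ab] by (intro continuous_open_preimage[OF dd(4,2)]) auto
      have "Y (chart_map c (chart_inv d w)) = 0" if "w \<in> T" "chart_inv d w \<in> chart_dom c" for w
      proof (rule Y(2))
        show "chart_map c (chart_inv d w) \<notin> cbox a b"
          using that c(5) unfolding T_def by (metis ComplD IntD2 image_eqI vimageE)
      qed (use that c in blast)
      then have "smooth_on T (local_rep d ?V)"
        by (intro smooth_on_cong[OF T _ smooth_on_const[of _ 0]]) (auto simp: local_rep_def)
      moreover have "u \<in> T" using u False chart_box_subdomain(3)[OF at ab] by (auto simp: T_def)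
      ultimately show ?thesis using T by blast
    qed
  qed
qed

text \<open>
  The rational parametrisation of the circle moves a unit vector \<open>n\<close> inside the sphere with
  initial velocity twice the given tangent vector \<open>v\<close>, without square roots.
\<close>

definition rotate_towards :: "'b::real_inner \<Rightarrow> 'b \<Rightarrow> real \<Rightarrow> 'b" where
  "rotate_towards n v t = inverse (1 + t\<^sup>2 * (v \<bullet> v)) *\<^sub>R ((1 - t\<^sup>2 * (v \<bullet> v)) *\<^sub>R n + (2 * t) *\<^sub>R v)"

lemma norm_rotate_towards:
  assumes "norm n = 1" "v \<bullet> n = 0"
  shows "norm (rotate_towards n v t) = 1"
proof -
  define r where "r = t\<^sup>2 * (v \<bullet> v)"
  have r: "1 + r > 0" unfolding r_def by (intro add_pos_nonneg mult_nonneg_nonneg) auto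
  have nn: "n \<bullet> n = 1" "n \<bullet> v = 0" using assms by (auto simp: norm_eq_sqrt_inner inner_commute)
  have "rotate_towards n v t \<bullet> rotate_towards n v t = inverse (1 + r) ^ 2 * ((1 - r)\<^sup>2 + 4 * r)"
    by (simp add: rotate_towards_def r_def[symmetric] inner_simps nn assms)
      (simp add: r_def algebra_simps power2_eq_square)
  also have "(1 - r)\<^sup>2 + 4 * r = (1 + r)\<^sup>2" by (simp add: power2_eq_square algebra_simps)
  also have "inverse (1 + r) ^ 2 * (1 + r)\<^sup>2 = 1" using r by (simp add: power_inverse)
  finally show ?thesis by (simp add: norm_eq_sqrt_inner)
qed

lemma rotate_towards_0 [simp]: "rotate_towards n v 0 = n" "rotate_towards n 0 t = n"
  by (simp_all add: rotate_towards_def)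

lemma rotate_towards_velocity:
  "((rotate_towards n v) has_vector_derivative 2 *\<^sub>R v) (at 0)"
  unfolding rotate_towards_def[abs_def]
  by (auto intro!: derivative_eq_intros)

lemma smooth_on_rotate_towards:
  fixes N V :: "'a::euclidean_space \<Rightarrow> 'b::euclidean_space"
  assumes "open S" "smooth_on S N" "smooth_on S V" "open I"
  shows "smooth_on (I \<times> S) (\<lambda>(t, u). rotate_towards (N u) (V u) t)"
proof -
  have o: "open (I \<times> S)" using assms open_Times by blast
  have f: "smooth_on (I \<times> S) fst" by (rule smooth_on_linear[OF bounded_linear_fst])
  have N: "smooth_on (I \<times> S) (\<lambda>z. N (snd z))"
    by (rule smooth_on_compose[OF o smooth_on_linear[OF bounded_linear_snd] assms(2)]) auto
  have V: "smooth_on (I \<times> S) (\<lambda>z. V (snd z))"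
    by (rule smooth_on_compose[OF o smooth_on_linear[OF bounded_linear_snd] assms(3)]) auto
  have r: "1 + t * t * (v \<bullet> v) > 0" for t and v :: 'b
    by (intro add_pos_nonneg mult_nonneg_nonneg[OF zero_le_square]) auto
  show ?thesis unfolding rotate_towards_def split_beta power2_eq_square
    by (intro smooth_on_scaleR smooth_on_inverse smooth_on_add smooth_on_diff smooth_on_mult smooth_on_inner
        smooth_on_const o f N V r)
qed

text \<open>
  The variation rotates \<open>\<eta>\<close> towards the field \<open>Y\<close>. Its energy is the integral over a fixed box of a function
  that is smooth in the parameter and the point jointly, so it may be differentiated under the integral. At
  time \<open>0\<close> the mixed derivatives in time and space commute, so the derivative of \<open>d(F t)\<close> is \<open>2 dY\<close>, and
  the quadratic form in \<open>dF\<close> becomes four times the bilinear form in \<open>d\<eta>\<close> and \<open>dY\<close>.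
\<close>

lemma first_variation:
  fixes \<A> :: "'m::t2_space chart set" and x :: "'m \<Rightarrow> 'b::euclidean_space" and \<eta> :: "'m \<Rightarrow> 'c::euclidean_space"
  assumes at: "smooth_atlas \<A>" "c \<in> \<A>" and im: "immersed_in_sphere \<A> x"
    and harm: "harmonic_into_sphere \<A> x \<eta>"
    and ab: "cbox a b \<subseteq> chart_image c" "box a b \<noteq> {}"
    and Y: "smooth_on (chart_image c) Y" "\<And>u. u \<in> chart_image c \<Longrightarrow> u \<notin> cbox a b \<Longrightarrow> Y u = 0"
    and orth: "\<And>u. u \<in> chart_image c \<Longrightarrow> Y u \<bullet> local_rep c \<eta> u = 0"
  shows "integral (cbox a b) (\<lambda>u. dirichlet_form (local_rep c x) e1 e2 (local_rep c \<eta>) Y u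
    * inverse (sqrt (gram_det (local_rep c x) e1 e2 u))) = 0"
proof -
  note c = smooth_atlasD[OF at]
  define U where "U = chart_image c"
  have U: "open U" using c by (simp add: U_def)
  define X N where "X = local_rep c x" and "N = local_rep c \<eta>"
  have X: "smooth_on U X" using im at by (simp add: immersed_in_sphere_def smooth_map_def X_def U_def)
  have sm: "smooth_map \<A> \<eta>" "\<And>p. norm (\<eta> p) = 1" using harm by (auto simp: harmonic_into_sphere_def)
  have N: "smooth_on U N" using sm(1) at by (simp add: smooth_map_def N_def U_def)
  define V where "V p = (if p \<in> chart_dom c then Y (chart_map c p) else 0)" for p
  have V: "smooth_map \<A> V" unfolding V_def[abs_def] by (rule smooth_map_extend_by_zero[OF at ab Y])
  have VY: "V (chart_inv c u) = Y u" if "u \<in> U" for u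
    using that chart_inv_in_dom chart_map_inv by (fastforce simp: U_def V_def)
  have Vorth: "V p \<bullet> \<eta> p = 0" for p
    using orth[OF c(6), of p] c(5) by (simp add: V_def local_rep_def)
  define F where "F t p = rotate_towards (\<eta> p) (V p) t" for t p
  define D where "D = chart_inv c ` cbox a b"
  note D = chart_box_subdomain[OF at ab, folded D_def]
  have VD: "V p = 0" if "p \<notin> D" for p
    using that Y(2)[OF c(6)] c(5) by (force simp: V_def D_def image_iff)
  have var: "sphere_variation \<A> \<eta> D 1 F"
    unfolding sphere_variation_def
  proof (intro conjI ballI allI impI)
    show "F 0 = \<eta>" by (simp add: F_def fun_eq_iff)
    show "F t p \<in> sphere 0 1" for t p using norm_rotate_towards[OF sm(2) Vorth] by (simp add: F_def)
    show "F t p = \<eta> p" if "p \<notin> D" for t p using VD[OF that] by (simp add: F_def)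
    fix d assume d: "d \<in> \<A>"
    have "smooth_on ({-1<..<1} \<times> chart_image d) (\<lambda>(t, u). rotate_towards (local_rep d \<eta> u) (local_rep d V u) t)"
      using sm(1) V d smooth_atlasD(2)[OF at(1) d]
      by (intro smooth_on_rotate_towards) (auto simp: smooth_map_def)
    then show "smooth_on ({-1<..<1} \<times> chart_image d) (\<lambda>(t, u). F t (chart_inv d u))"
      by (simp add: F_def local_rep_def)
  qed
  define \<Phi> where "\<Phi> = (\<lambda>(t, u). rotate_towards (N u) (Y u) t)"
  define S where "S = {-1<..<1::real} \<times> U"
  have S: "open S" using U by (simp add: S_def open_Times)
  have \<Phi>: "smooth_on S \<Phi>" unfolding S_def \<Phi>_def
    using smooth_on_rotate_towards[OF U N Y(1)[folded U_def]] by simp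
  have partial: "dir_deriv v (\<lambda>u. \<Psi> (t, u)) u = dir_deriv (0, v) \<Psi> (t, u)"
    if "\<Psi> differentiable (at (t, u))" for \<Psi> :: "real \<times> (real^2) \<Rightarrow> 'c" and v t u
  proof (rule dir_deriv_eq)
    have 1: "((\<lambda>u. (t, u)) has_derivative (\<lambda>v. (0, v))) (at u)"
      by (intro has_derivative_Pair has_derivative_const has_derivative_ident)
    show "((\<lambda>u. \<Psi> (t, u)) has_derivative (\<lambda>v. dir_deriv (0, v) \<Psi> (t, u))) (at u)"
      using has_derivative_compose[OF 1 has_derivative_dir_deriv[OF that]] .
  qed
  define \<rho> where "\<rho> u = inverse (sqrt (gram_det X e1 e2 u))" for u
  have gpos: "gram_det X e1 e2 u > 0" if "u \<in> U" for u
    using gram_det_chart_pos[OF at(1) im at(2) _ axis_independent] that by (simp add: X_def U_def)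
  have \<rho>: "smooth_on U \<rho>" unfolding \<rho>_def[abs_def]
    by (rule smooth_on_inverse_sqrt[OF U smooth_on_gram_det[OF U X] gpos])
  define A where "A v z = dir_deriv (0, v) \<Phi> z" for v z
  \<comment> \<open>The energy integrand of \<open>F t\<close> at \<open>u\<close>, as a function of \<open>z = (t, u)\<close>.\<close>
  define e where "e z = (first_form X e2 e2 (snd z) * (A e1 z \<bullet> A e1 z)
    - first_form X e1 e2 (snd z) * (A e1 z \<bullet> A e2 z + A e2 z \<bullet> A e1 z)
    + first_form X e1 e1 (snd z) * (A e2 z \<bullet> A e2 z)) * \<rho> (snd z)" for z
  have A: "smooth_on S (A v)" for v
    unfolding A_def[abs_def] by (rule smooth_on_dir_deriv[OF \<Phi>])
  have snd: "smooth_on S (\<lambda>z. f (snd z))" if "smooth_on U f" for f :: "real^2 \<Rightarrow> real"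
    by (rule smooth_on_compose[OF S smooth_on_linear[OF bounded_linear_snd] that]) (auto simp: S_def)
  have e: "smooth_on S e" unfolding e_def[abs_def]
    by (intro smooth_on_mult smooth_on_add smooth_on_diff smooth_on_inner S A snd \<rho> smooth_on_first_form U X)
  have F\<Phi>: "local_rep c (F t) u = \<Phi> (t, u)" if "u \<in> U" for t u
    using VY[OF that] by (simp add: local_rep_def F_def \<Phi>_def N_def)
  have eF: "energy_integrand c x (F t) u = e (t, u)" if "t \<in> {-1<..<1}" "u \<in> U" for t u
  proof -
    have "dir_deriv v (local_rep c (F t)) u = A v (t, u)" for v
      using dir_deriv_cong[OF U that(2) F\<Phi>[of _ t], where v=v] partial[of \<Phi> t u v]
        smooth_on_differentiable[OF \<Phi>, of "(t, u)"] that by (simp add: S_def A_def)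
    then show ?thesis
      using energy_integrand_eq[of u c x "F t"] that gpos[OF that(2)]
      by (simp add: U_def dirichlet_form_def e_def X_def \<rho>_def)
  qed
  have abU: "cbox a b \<subseteq> U" using ab by (simp add: U_def)
  have ct: "continuous_on (cbox a b) (\<lambda>u. e (t, u))" if "t \<in> {-1<..<1}" for t
    using that abU
    by (intro continuous_on_compose2[OF smooth_on_continuous[OF e]] continuous_intros) (auto simp: S_def)
  define E where "E t = integral (cbox a b) (\<lambda>u. e (t, u))" for t
  have energy: "has_energy \<A> x (F t) D (E t)" if t: "t \<in> {-1<..<1}" for t
  proof -
    have ceq: "continuous_on (cbox a b) (energy_integrand c x (F t))"
      by (rule continuous_on_eq[OF ct[OF t]]) (use eF[OF t] abU in \<open>simp add: subset_iff\<close>)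
    then have int: "set_integrable lborel (cbox a b) (energy_integrand c x (F t))"
      unfolding set_integrable_def by (intro borel_integrable_compact) simp_all
    have "(LINT u:cbox a b|lborel. energy_integrand c x (F t) u) = E t"
      using set_borel_integral_eq_integral(2)[OF int] eF[OF t] abU
      unfolding E_def by (auto intro!: integral_cong)
    then show ?thesis unfolding has_energy_def
      using int at D by (intro exI[of _ "1::nat"] exI[of _ "\<lambda>_. c"] exI[of _ "\<lambda>_. D"])
        (auto simp: disjoint_family_on_def lessThan_Suc)
  qed
  have E0: "(E has_real_derivative 0) (at 0)"
    using harm D(1) var energy unfolding harmonic_into_sphere_def by (meson zero_less_one)
  have "(E has_real_derivative integral (cbox a b) (\<lambda>u. dir_deriv (1, 0) e (0, u))) (at 0 within {-1<..<1})"
    unfolding E_def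
  proof (rule leibniz_rule_field_derivative[where f="\<lambda>t u. e (t, u)" and fx="\<lambda>t u. dir_deriv (1, 0) e (t, u)"])
    fix t u assume t: "t \<in> {-1<..<1::real}" "u \<in> cbox a b"
    then have "e differentiable (at ((0, u) + t *\<^sub>R (1, 0)))"
      using abU by (intro smooth_on_differentiable[OF e]) (auto simp: S_def)
    from line_has_derivative[OF this]
    show "((\<lambda>t. e (t, u)) has_real_derivative dir_deriv (1, 0) e (t, u)) (at t within {-1<..<1})"
      unfolding has_real_derivative_iff_has_vector_derivative
      by (simp add: has_vector_derivative_at_within)
  next
    show "continuous_on ({-1<..<1} \<times> cbox a b) (\<lambda>(t, u). dir_deriv (1, 0) e (t, u))"
      using continuous_on_subset[OF smooth_on_continuous[OF smooth_on_dir_deriv[OF e, of "(1, 0)"], unfolded S_def]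
          Sigma_mono[OF order_refl abU]]
      by (simp add: split_beta)
    show "(\<lambda>u. e (t, u)) integrable_on cbox a b" if "t \<in> {-1<..<1}" for t
      using integrable_continuous[OF ct[OF that]] .
  qed auto
  then have "(E has_real_derivative integral (cbox a b) (\<lambda>u. dir_deriv (1, 0) e (0, u))) (at 0)"
    by (simp add: at_within_open[of 0 "{-1<..<1}"])
  with E0 have "integral (cbox a b) (\<lambda>u. dir_deriv (1, 0) e (0, u)) = 0" using DERIV_unique by blast
  moreover have "dir_deriv (1, 0) e (0, u) = 4 * (dirichlet_form X e1 e2 N Y u * \<rho> u)" if u: "u \<in> U" for u
  proof -
    have 0: "(0, u) \<in> S" using u by (simp add: S_def)
    have vel: "dir_deriv (1, 0) \<Phi> (0, w) = 2 *\<^sub>R Y w" if "w \<in> U" for w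
    proof -
      have "\<Phi> differentiable (at ((0, w) + 0 *\<^sub>R (1, 0)))"
        using that by (intro smooth_on_differentiable[OF \<Phi>]) (auto simp: S_def)
      from line_has_derivative[OF this]
      have "(rotate_towards (N w) (Y w) has_vector_derivative dir_deriv (1, 0) \<Phi> (0, w)) (at 0)"
        by (simp add: \<Phi>_def)
      then show ?thesis using rotate_towards_velocity vector_derivative_unique_at by blast
    qed
    have A0: "A v (0, u) = dir_deriv v N u" for v
      using partial[of \<Phi> 0 u v] smooth_on_differentiable[OF \<Phi> 0] by (simp add: A_def \<Phi>_def)
    have dA: "dir_deriv (1, 0) (A v) (0, u) = 2 *\<^sub>R dir_deriv v Y u" for v
    proof -
      have "dir_deriv (1, 0) (A v) (0, u) = dir_deriv (0, v) (dir_deriv (1, 0) \<Phi>) (0, u)"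
        using dir_deriv_commute[OF S 0 \<Phi>] by (simp add: A_def[abs_def])
      also have "\<dots> = dir_deriv v (\<lambda>u. dir_deriv (1, 0) \<Phi> (0, u)) u"
        using partial smooth_on_differentiable[OF smooth_on_dir_deriv[OF \<Phi>] 0] by simp
      also have "\<dots> = dir_deriv v (\<lambda>u. 2 *\<^sub>R Y u) u" by (rule dir_deriv_cong[OF U u vel])
      also have "\<dots> = 2 *\<^sub>R dir_deriv v Y u"
        using dir_deriv_scaleR[of "\<lambda>_. 2" u Y v] smooth_on_differentiable[OF Y(1)] u by (simp add: U_def)
      finally show ?thesis .
    qed
    have dS: "g differentiable (at (0, u))" if "smooth_on S g" for g :: "real \<times> (real^2) \<Rightarrow> real"
      using smooth_on_differentiable[OF that 0] .
    have dsnd: "dir_deriv (1, 0) (\<lambda>z. f (snd z)) (0::real, u) = 0" if f: "smooth_on U f" for f :: "real^2 \<Rightarrow> real"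
    proof -
      have d: "(f has_derivative (\<lambda>v. dir_deriv v f u)) (at (snd (0::real, u)))"
        using has_derivative_dir_deriv smooth_on_differentiable[OF f u] by fastforce
      have "((\<lambda>z. f (snd z)) has_derivative (\<lambda>z. dir_deriv (snd z) f u)) (at (0::real, u))"
        using has_derivative_compose[OF bounded_linear_imp_has_derivative[OF bounded_linear_snd], of f] d by blast
      from dir_deriv_eq[OF this, of "(1, 0)"] show ?thesis
        using linear_0[OF has_derivative_linear[OF d]] by simp
    qed
    note ff = smooth_on_first_form[OF U X]
    note sm = smooth_on_mult[OF S] smooth_on_add[OF S] smooth_on_diff[OF S] smooth_on_inner[OF S A A] snd[OF ff] snd[OF \<rho>]
    have inn: "dir_deriv (1, 0) (\<lambda>z. A v z \<bullet> A w z) (0, u) =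
        2 * (dir_deriv v N u \<bullet> dir_deriv w Y u) + 2 * (dir_deriv v Y u \<bullet> dir_deriv w N u)" for v w
      using dir_deriv_inner[OF smooth_on_differentiable[OF A 0] smooth_on_differentiable[OF A 0]]
      by (simp add: dA A0)
    show ?thesis unfolding e_def[abs_def]
      by (simp add: dir_deriv_mult dir_deriv_add dir_deriv_diff dS sm inn dsnd[OF ff] dsnd[OF \<rho>] A0 dirichlet_form_def)
        (simp add: algebra_simps inner_commute)
  qed
  ultimately have "integral (cbox a b) (\<lambda>u. 4 * (dirichlet_form X e1 e2 N Y u * \<rho> u)) = 0"
    using abU by (metis (no_types, lifting) integral_cong subsetD)
  then show ?thesis by (simp add: X_def N_def \<rho>_def)
qed


section \<open>The tangential Euler--Lagrange equation\<close>

text \<open>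
  The product of \<open>Z\<close> with the bump extends by zero to the whole space, where the integral of a directional
  derivative vanishes.
\<close>

lemma integral_by_parts_bump:
  fixes Z :: "'a::euclidean_space \<Rightarrow> real"
  assumes U: "open U" and Z: "smooth_on U Z" and ab: "cbox a b \<subseteq> U"
    and r: "r > 0" "cball p r \<subseteq> cbox a b"
  shows "integral (cbox a b) (\<lambda>u. dir_deriv v (bump p r) u * Z u)
    = - integral (cbox a b) (\<lambda>u. bump p r u * dir_deriv v Z u)"
proof -
  define f where "f u = (if u \<in> U then bump p r u * Z u else 0)" for u
  have b0: "bump p r u = 0" if "u \<notin> cbox a b" for u
  proof -
    have "u \<notin> cball p r" using that r by blast
    then show ?thesis using r by (intro bump_eq_0) (auto simp: dist_norm norm_minus_commute)
  qed
  have fU: "smooth_on U f"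
    by (rule smooth_on_cong[OF U _ smooth_on_mult[OF U smooth_on_bump[OF U, of p r] Z]]) (simp add: f_def)
  have f0: "smooth_on (- cbox a b) f"
    by (rule smooth_on_cong[OF _ _ smooth_on_const[of _ 0]]) (auto simp: f_def b0 open_Compl closed_cbox)
  have f: "smooth_on UNIV f"
  proof (rule smooth_on_local)
    fix u
    show "\<exists>T. open T \<and> u \<in> T \<and> smooth_on T f"
      using fU f0 U ab open_Compl[OF closed_cbox[of a b]] by (cases "u \<in> U") auto
  qed
  have "integral (cbox a b) (dir_deriv v f) = 0"
    by (rule integral_dir_deriv_eq_0[OF smooth_on_differentiable[OF f] smooth_on_continuous[OF smooth_on_dir_deriv[OF f]]])
      (auto simp: f_def b0)
  moreover have "dir_deriv v f u = bump p r u * dir_deriv v Z u + dir_deriv v (bump p r) u * Z u"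
    if "u \<in> cbox a b" for u
  proof -
    have u: "u \<in> U" using that ab by blast
    have "dir_deriv v f u = dir_deriv v (\<lambda>u. bump p r u * Z u) u"
      by (rule dir_deriv_cong[OF U u]) (simp add: f_def)
    also have "\<dots> = bump p r u * dir_deriv v Z u + dir_deriv v (bump p r) u * Z u"
      by (rule dir_deriv_mult[OF smooth_on_differentiable[OF smooth_on_bump[OF U] u] smooth_on_differentiable[OF Z u]])
    finally show ?thesis .
  qed
  ultimately have "integral (cbox a b) (\<lambda>u. bump p r u * dir_deriv v Z u + dir_deriv v (bump p r) u * Z u) = 0"
    by (metis (no_types, lifting) integral_cong)
  moreover have "(\<lambda>u. bump p r u * dir_deriv v Z u) integrable_on cbox a b"
    "(\<lambda>u. dir_deriv v (bump p r) u * Z u) integrable_on cbox a b"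
    using ab by (intro integrable_continuous continuous_on_subset[OF smooth_on_continuous[of U]]
        smooth_on_mult smooth_on_dir_deriv smooth_on_bump U Z; simp)+
  ultimately show ?thesis by (simp add: integral_add)
qed

text \<open>
  If \<open>h p \<noteq> 0\<close>, the function \<open>h\<close> has a constant sign on a small box at \<open>p\<close>, and its integral against a bump
  at \<open>p\<close> inside that box cannot vanish.
\<close>

lemma bump_test_imp_0:
  fixes h :: "'a::euclidean_space \<Rightarrow> real"
  assumes U: "open U" "p \<in> U" and h: "continuous_on U h"
    and test: "\<And>a b r. cbox a b \<subseteq> U \<Longrightarrow> p \<in> box a b \<Longrightarrow> r > 0 \<Longrightarrow> cball p r \<subseteq> cbox a b \<Longrightarrow>
      integral (cbox a b) (\<lambda>u. bump p r u * h u) = 0"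
  shows "h p = 0"
proof (rule ccontr)
  assume hp: "h p \<noteq> 0"
  define W where "W = U \<inter> (\<lambda>u. h u * h p) -` {0<..}"
  have "open W" unfolding W_def
    by (rule continuous_open_preimage) (auto intro!: continuous_intros h U)
  moreover have "p \<in> W" using U hp by (auto simp: W_def zero_less_mult_iff)
  ultimately obtain a b where ab: "cbox a b \<subseteq> W" "p \<in> box a b"
    using open_contains_cbox by metis
  obtain r where r: "r > 0" "cball p r \<subseteq> box a b"
    using open_box[of a b] ab(2) open_contains_cball by blast
  let ?g = "\<lambda>u. bump p r u * h u * h p"
  have abU: "cbox a b \<subseteq> U" using ab by (auto simp: W_def)
  have "integral (cbox a b) (\<lambda>u. bump p r u * h u) = 0"
    using r box_subset_cbox[of a b] by (intro test abU ab(2)) auto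
  then have "integral (cbox a b) ?g = 0" by (simp add: integral_mult_left)
  moreover have c: "continuous_on (cbox a b) ?g"
    by (intro continuous_on_mult continuous_on_const continuous_on_subset[OF h abU]
        smooth_on_continuous[OF smooth_on_subset[OF smooth_on_bump[OF open_UNIV]]]) simp
  moreover have "?g u \<ge> 0" if "u \<in> cbox a b" for u
  proof -
    have "h u * h p > 0" using that ab by (auto simp: W_def)
    then show ?thesis using bump_nonneg[of p r u] by (simp add: mult.assoc)
  qed
  ultimately have "?g p = 0"
    using has_integral_0_cbox_imp_0[OF c, of p] integrable_integral[OF integrable_continuous[OF c]] ab(2)
      box_subset_cbox[of a b] by force
  moreover have "bump p r p > 0" using r by (intro bump_pos) simp
  ultimately show False using hp by simp
qed

text \<open>
  The conclusion of the first variation formula, for arbitrary coordinate vectors \<open>v\<close>, \<open>w\<close> so that it can be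
  transferred to a basis that is orthonormal at a given point.
\<close>

definition weakly_stationary ::
  "(real^2) set \<Rightarrow> (real^2 \<Rightarrow> 'b::euclidean_space) \<Rightarrow> real^2 \<Rightarrow> real^2 \<Rightarrow> (real^2 \<Rightarrow> 'c::euclidean_space) \<Rightarrow> bool" where
  "weakly_stationary U X v w N \<longleftrightarrow> (\<forall>a b Y. cbox a b \<subseteq> U \<longrightarrow> box a b \<noteq> {} \<longrightarrow> smooth_on U Y \<longrightarrow>
     (\<forall>u\<in>U. u \<notin> cbox a b \<longrightarrow> Y u = 0) \<longrightarrow> (\<forall>u\<in>U. Y u \<bullet> N u = 0) \<longrightarrow>
     integral (cbox a b) (\<lambda>u. dirichlet_form X v w N Y u * inverse (sqrt (gram_det X v w u))) = 0)"

text \<open>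
  This is the equation \<open>\<langle>\<Delta>N, T\<rangle> = 0\<close> multiplied by the area element, in divergence form and with the
  derivative of \<open>T\<close> moved to the left-hand side. It follows by testing with the fields
  \<open>bump *\<^sub>R T\<close> and integrating by parts.
\<close>

lemma euler_lagrange:
  fixes X N T :: "real^2 \<Rightarrow> 'b::euclidean_space"
  assumes U: "open U" "p \<in> U" and X: "smooth_on U X" and N: "smooth_on U N" and T: "smooth_on U T"
    and pos: "\<And>u. u \<in> U \<Longrightarrow> gram_det X v w u > 0"
    and stat: "weakly_stationary U X v w N"
    and TN: "\<And>u. u \<in> U \<Longrightarrow> T u \<bullet> N u = 0"
  shows "dirichlet_form X v w N T p * inverse (sqrt (gram_det X v w p)) =
    dir_deriv v (\<lambda>u. (first_form X w w u * (dir_deriv v N u \<bullet> T u) - first_form X v w u * (dir_deriv w N u \<bullet> T u))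
      * inverse (sqrt (gram_det X v w u))) p
  + dir_deriv w (\<lambda>u. (first_form X v v u * (dir_deriv w N u \<bullet> T u) - first_form X v w u * (dir_deriv v N u \<bullet> T u))
      * inverse (sqrt (gram_det X v w u))) p"
proof -
  define \<rho> where "\<rho> u = inverse (sqrt (gram_det X v w u))" for u
  define Z1 where "Z1 u = (first_form X w w u * (dir_deriv v N u \<bullet> T u) - first_form X v w u * (dir_deriv w N u \<bullet> T u)) * \<rho> u" for u
  define Z2 where "Z2 u = (first_form X v v u * (dir_deriv w N u \<bullet> T u) - first_form X v w u * (dir_deriv v N u \<bullet> T u)) * \<rho> u" for u
  define S where "S u = dirichlet_form X v w N T u * \<rho> u" for u
  have \<rho>: "smooth_on U \<rho>" unfolding \<rho>_def[abs_def]
    by (rule smooth_on_inverse_sqrt[OF U(1) smooth_on_gram_det[OF U(1) X] pos])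
  have Z1: "smooth_on U Z1" unfolding Z1_def[abs_def]
    by (intro smooth_on_mult smooth_on_diff smooth_on_first_form smooth_on_inner smooth_on_dir_deriv U X N T \<rho>)
  have Z2: "smooth_on U Z2" unfolding Z2_def[abs_def]
    by (intro smooth_on_mult smooth_on_diff smooth_on_first_form smooth_on_inner smooth_on_dir_deriv U X N T \<rho>)
  have S: "smooth_on U S" unfolding S_def[abs_def] dirichlet_form_def
    by (intro smooth_on_mult smooth_on_add smooth_on_diff smooth_on_first_form smooth_on_inner smooth_on_dir_deriv U X N T \<rho>)
  define h where "h u = S u - dir_deriv v Z1 u - dir_deriv w Z2 u" for u
  have h: "smooth_on U h" unfolding h_def[abs_def]
    by (intro smooth_on_diff smooth_on_dir_deriv S Z1 Z2 U)
  have "h p = 0"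
  proof (rule bump_test_imp_0[OF U smooth_on_continuous[OF h]])
    fix a b and r :: real
    assume ab: "cbox a b \<subseteq> U" "p \<in> box a b" and r: "r > 0" "cball p r \<subseteq> cbox a b"
    note \<beta> = smooth_on_bump[OF U(1), of p r]
    let ?Y = "\<lambda>u. bump p r u *\<^sub>R T u"
    have b0: "bump p r u = 0" if "u \<notin> cbox a b" for u
    proof -
      have "u \<notin> cball p r" using that r by blast
      then show ?thesis using r by (intro bump_eq_0) (auto simp: dist_norm norm_minus_commute)
    qed
    have i0: "integral (cbox a b) (\<lambda>u. dirichlet_form X v w N ?Y u * \<rho> u) = 0"
      using stat[unfolded weakly_stationary_def, rule_format, of a b ?Y] ab
        smooth_on_scaleR[OF U(1) \<beta> T] b0 TN by (auto simp: \<rho>_def)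
    have eq: "dirichlet_form X v w N ?Y u * \<rho> u =
        bump p r u * S u + dir_deriv v (bump p r) u * Z1 u + dir_deriv w (bump p r) u * Z2 u" if "u \<in> cbox a b" for u
    proof -
      have u: "u \<in> U" using that ab by blast
      have "dir_deriv z ?Y u = bump p r u *\<^sub>R dir_deriv z T u + dir_deriv z (bump p r) u *\<^sub>R T u" for z
        by (rule dir_deriv_scaleR[OF smooth_on_differentiable[OF \<beta> u] smooth_on_differentiable[OF T u]])
      then show ?thesis
        by (simp add: dirichlet_form_def S_def Z1_def Z2_def inner_simps algebra_simps)
    qed
    have 0: "integral (cbox a b) (\<lambda>u. bump p r u * S u + dir_deriv v (bump p r) u * Z1 u
        + dir_deriv w (bump p r) u * Z2 u) = 0"
      by (rule trans[OF integral_cong i0]) (rule eq[symmetric])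
    have int: "f integrable_on cbox a b" if "smooth_on U f" for f :: "real^2 \<Rightarrow> real"
      using integrable_continuous[OF continuous_on_subset[OF smooth_on_continuous[OF that] ab(1)]] .
    note sm = int[OF smooth_on_mult[OF U(1) \<beta>]] int[OF smooth_on_mult[OF U(1) smooth_on_dir_deriv[OF \<beta>]]]
    have "integral (cbox a b) (\<lambda>u. bump p r u * S u) - integral (cbox a b) (\<lambda>u. bump p r u * dir_deriv v Z1 u)
        - integral (cbox a b) (\<lambda>u. bump p r u * dir_deriv w Z2 u) = 0"
      using 0 integral_by_parts_bump[OF U(1) Z1 ab(1) r, of v] integral_by_parts_bump[OF U(1) Z2 ab(1) r, of w]
      by (simp add: integral_add integrable_add sm S Z1 Z2)
    then show "integral (cbox a b) (\<lambda>u. bump p r u * h u) = 0"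
      unfolding h_def right_diff_distrib
      by (simp add: integral_diff integrable_diff sm S smooth_on_dir_deriv Z1 Z2)
  qed
  then show ?thesis by (simp add: h_def S_def Z1_def[abs_def] Z2_def[abs_def] \<rho>_def)
qed

section \<open>The normal connection at a point\<close>

text \<open>
  At a point where \<open>g = 1\<close> the weight \<open>1/\<surd>g\<close> contributes only \<open>- g'/2\<close> to a derivative.
\<close>

lemma dir_deriv_weighted:
  fixes g f1 f2 k1 k2 :: "'a::real_normed_vector \<Rightarrow> real"
  assumes d: "g differentiable (at p)" "f1 differentiable (at p)" "f2 differentiable (at p)"
      "k1 differentiable (at p)" "k2 differentiable (at p)"
    and 1: "g p = 1" "f1 p = 1" "f2 p = 0"
  shows "dir_deriv v (\<lambda>u. (f1 u * k1 u - f2 u * k2 u) * inverse (sqrt (g u))) p =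
    dir_deriv v f1 p * k1 p + dir_deriv v k1 p - dir_deriv v f2 p * k2 p - dir_deriv v g p * k1 p / 2"
proof -
  note h = d[THEN has_derivative_dir_deriv]
  have s: "((\<lambda>x. inverse (sqrt x)) has_derivative (*) (- 1/2)) (at (g p))"
    using inverse_sqrt_has_derivative[of "g p"] 1 by (simp add: has_field_derivative_def)
  have r: "((\<lambda>u. inverse (sqrt (g u))) has_derivative (\<lambda>v. (- 1/2) * dir_deriv v g p)) (at p)"
    using has_derivative_compose[OF h(1), of "\<lambda>x. inverse (sqrt x)"] s by blast
  show ?thesis
    by (rule dir_deriv_eq[THEN trans],
        rule has_derivative_mult[OF has_derivative_diff[OF has_derivative_mult[OF h(2,4)] has_derivative_mult[OF h(3,5)]] r])
      (simp add: 1)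
qed

text \<open>
  With \<open>v\<close>, \<open>w\<close> orthonormal at \<open>p\<close>, the derivatives of the metric collect to the tangential part of
  \<open>X\<^sub>v\<^sub>v + X\<^sub>w\<^sub>w\<close>, which is the correction between the coordinate and the geometric Laplacian.
\<close>

lemma euler_lagrange_orthonormal:
  fixes X N T :: "real^2 \<Rightarrow> 'b::euclidean_space"
  assumes U: "open U" "p \<in> U" and X: "smooth_on U X" and N: "smooth_on U N" and T: "smooth_on U T"
    and pos: "\<And>u. u \<in> U \<Longrightarrow> gram_det X v w u > 0"
    and stat: "weakly_stationary U X v w N"
    and TN: "\<And>u. u \<in> U \<Longrightarrow> T u \<bullet> N u = 0"
    and on: "first_form X v v p = 1" "first_form X w w p = 1" "first_form X v w p = 0"
  shows "(dir_deriv v (dir_deriv v N) p + dir_deriv w (dir_deriv w N) p) \<bullet> T p =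
    (dir_deriv v N p \<bullet> T p) * (dir_deriv v X p \<bullet> (dir_deriv v (dir_deriv v X) p + dir_deriv w (dir_deriv w X) p))
  + (dir_deriv w N p \<bullet> T p) * (dir_deriv w X p \<bullet> (dir_deriv v (dir_deriv v X) p + dir_deriv w (dir_deriv w X) p))"
proof -
  note diff = smooth_on_differentiable[OF _ U(2)]
  have d: "dir_deriv z X differentiable at p" "dir_deriv z N differentiable at p" "T differentiable at p" for z
    using diff smooth_on_dir_deriv X N T by blast+
  have df: "first_form X y z differentiable at p" for y z
    by (rule diff[OF smooth_on_first_form[OF U(1) X]])
  have dg: "gram_det X v w differentiable at p"
    by (rule diff[OF smooth_on_gram_det[OF U(1) X]])
  have dk: "(\<lambda>u. dir_deriv z N u \<bullet> T u) differentiable at p" for z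
    by (rule diff[OF smooth_on_inner[OF U(1) smooth_on_dir_deriv[OF N] T]])
  have g1: "gram_det X v w p = 1" by (simp add: gram_det_def on)
  have g': "dir_deriv z (gram_det X v w) p = dir_deriv z (first_form X v v) p + dir_deriv z (first_form X w w) p" for z
    unfolding gram_det_def[abs_def] power2_eq_square
    by (simp add: dir_deriv_diff dir_deriv_mult df on differentiable_mult)
  have f': "dir_deriv z (first_form X y y') p =
      dir_deriv y X p \<bullet> dir_deriv z (dir_deriv y' X) p + dir_deriv z (dir_deriv y X) p \<bullet> dir_deriv y' X p" for y y' z
    unfolding first_form_def[abs_def] by (rule dir_deriv_inner[OF d(1) d(1)])
  have k': "dir_deriv z (\<lambda>u. dir_deriv y N u \<bullet> T u) p = dir_deriv y N p \<bullet> dir_deriv z T p + dir_deriv z (dir_deriv y N) p \<bullet> T p" for y z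
    by (rule dir_deriv_inner[OF d(2) d(3)])
  have c: "dir_deriv w (dir_deriv v X) p = dir_deriv v (dir_deriv w X) p" by (rule dir_deriv_commute[OF U X])
  show ?thesis
    using euler_lagrange[OF assms(1-8)]
      dir_deriv_weighted[OF dg df df dk dk g1 on(2,3), of v v w] dir_deriv_weighted[OF dg df df dk dk g1 on(1,3), of w w v]
    by (simp add: g1 dirichlet_form_def on g' f' k' c inner_simps)
      (simp add: algebra_simps add_divide_distrib inner_commute)
qed

text \<open>
  Derivative of the relation \<open>N \<bullet> dX = 0\<close>.
\<close>

lemma weingarten:
  fixes X N :: "real^2 \<Rightarrow> 'b::euclidean_space"
  assumes U: "open U" "u \<in> U" and X: "smooth_on U X" and N: "smooth_on U N"
    and XN: "\<And>u z. u \<in> U \<Longrightarrow> N u \<bullet> dir_deriv z X u = 0"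
  shows "dir_deriv y N u \<bullet> dir_deriv z X u = - (N u \<bullet> dir_deriv y (dir_deriv z X) u)"
proof -
  have "dir_deriv y (\<lambda>u. N u \<bullet> dir_deriv z X u) u = dir_deriv y (\<lambda>_. 0) u"
    by (rule dir_deriv_cong[OF U]) (simp add: XN)
  moreover have "dir_deriv y (\<lambda>u. N u \<bullet> dir_deriv z X u) u =
      N u \<bullet> dir_deriv y (dir_deriv z X) u + dir_deriv y N u \<bullet> dir_deriv z X u"
    by (rule dir_deriv_inner[OF smooth_on_differentiable[OF N U(2)] smooth_on_differentiable[OF smooth_on_dir_deriv[OF X] U(2)]])
  ultimately show ?thesis by simp
qed

text \<open>
  The \<open>v\<close>-component of \<open>S\<^sub>\<nu> \<omega> = 0\<close>. The Euler--Lagrange equation contains \<open>N\<^sub>v\<^sub>v + N\<^sub>w\<^sub>w\<close>. Differentiating the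
  symmetry of \<open>dN \<bullet> dX\<close> along \<open>w\<close> and its vanishing trace along \<open>v\<close> expresses
  \<open>(N\<^sub>v\<^sub>v + N\<^sub>w\<^sub>w) \<bullet> X\<^sub>v\<close> by first derivatives of \<open>N\<close> and second derivatives of \<open>X\<close>; this is the traced Codazzi
  equation. Expanding \<open>dN\<close> in the frame and \<open>\<nu>\<close>, all terms with the tangential parts of the second derivatives
  of \<open>X\<close> cancel.
\<close>

lemma stationary_normal_connection:
  fixes X N :: "real^2 \<Rightarrow> 'b::euclidean_space"
  assumes U: "open U" "p \<in> U" and X: "smooth_on U X" and N: "smooth_on U N"
    and XN: "\<And>u z. u \<in> U \<Longrightarrow> N u \<bullet> dir_deriv z X u = 0"
    and pos: "\<And>u. u \<in> U \<Longrightarrow> gram_det X v w u > 0"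
    and stat: "weakly_stationary U X v w N"
    and min: "\<And>u. u \<in> U \<Longrightarrow> first_form X w w u * (dir_deriv v N u \<bullet> dir_deriv v X u)
      - 2 * first_form X v w u * (dir_deriv v N u \<bullet> dir_deriv w X u)
      + first_form X v v u * (dir_deriv w N u \<bullet> dir_deriv w X u) = 0"
    and on: "first_form X v v p = 1" "first_form X w w p = 1" "first_form X v w p = 0"
    and dec: "\<And>z. dir_deriv z N p = (dir_deriv z N p \<bullet> dir_deriv v X p) *\<^sub>R dir_deriv v X p
      + (dir_deriv z N p \<bullet> dir_deriv w X p) *\<^sub>R dir_deriv w X p + (dir_deriv z N p \<bullet> \<nu>) *\<^sub>R \<nu>"
    and min\<nu>: "dir_deriv v (dir_deriv v X) p \<bullet> \<nu> + dir_deriv w (dir_deriv w X) p \<bullet> \<nu> = 0"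
  shows "(dir_deriv v N p \<bullet> \<nu>) * (dir_deriv v (dir_deriv v X) p \<bullet> \<nu>)
       + (dir_deriv w N p \<bullet> \<nu>) * (dir_deriv v (dir_deriv w X) p \<bullet> \<nu>) = 0"
proof -
  define X1 X2 N1 N2 where "X1 = dir_deriv v X p" and "X2 = dir_deriv w X p"
    and "N1 = dir_deriv v N p" and "N2 = dir_deriv w N p"
  define X11 X12 X22 where "X11 = dir_deriv v (dir_deriv v X) p"
    and "X12 = dir_deriv v (dir_deriv w X) p" and "X22 = dir_deriv w (dir_deriv w X) p"
  define N11 N12 N22 where "N11 = dir_deriv v (dir_deriv v N) p"
    and "N12 = dir_deriv v (dir_deriv w N) p" and "N22 = dir_deriv w (dir_deriv w N) p"
  have c: "dir_deriv w (dir_deriv v X) p = X12" "dir_deriv w (dir_deriv v N) p = N12"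
    using dir_deriv_commute[OF U X] dir_deriv_commute[OF U N] by (auto simp: X12_def N12_def)
  note names = X1_def[symmetric] X2_def[symmetric] N1_def[symmetric] N2_def[symmetric]
    X11_def[symmetric] X12_def[symmetric] X22_def[symmetric]
    N11_def[symmetric] N12_def[symmetric] N22_def[symmetric] c
  note diff = smooth_on_differentiable[OF _ U(2)]
  have d: "dir_deriv z X differentiable at p" "dir_deriv z N differentiable at p" for z
    using diff smooth_on_dir_deriv X N by blast+
  have df: "first_form X y z differentiable at p" for y z
    by (rule diff[OF smooth_on_first_form[OF U(1) X]])
  have dk: "(\<lambda>u. dir_deriv y N u \<bullet> dir_deriv z X u) differentiable at p" for y z
    by (rule diff[OF smooth_on_inner[OF U(1) smooth_on_dir_deriv[OF N] smooth_on_dir_deriv[OF X]]])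
  have f': "dir_deriv z (first_form X y y') p =
      dir_deriv y X p \<bullet> dir_deriv z (dir_deriv y' X) p + dir_deriv z (dir_deriv y X) p \<bullet> dir_deriv y' X p" for y y' z
    unfolding first_form_def[abs_def] by (rule dir_deriv_inner[OF d(1) d(1)])
  have k': "dir_deriv z (\<lambda>u. dir_deriv y N u \<bullet> dir_deriv y' X u) p =
      dir_deriv y N p \<bullet> dir_deriv z (dir_deriv y' X) p + dir_deriv z (dir_deriv y N) p \<bullet> dir_deriv y' X p" for y y' z
    by (rule dir_deriv_inner[OF d(2) d(1)])
  \<comment> \<open>The tangent field \<open>T\<close> of the Euler--Lagrange equation is the coordinate field \<open>X\<^sub>v\<close>.\<close>
  have EL: "(N11 + N22) \<bullet> X1 = (N1 \<bullet> X1) * (X1 \<bullet> (X11 + X22)) + (N2 \<bullet> X1) * (X2 \<bullet> (X11 + X22))"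
    using euler_lagrange_orthonormal[OF U X N smooth_on_dir_deriv[OF X, of v] pos stat _ on] XN
    by (simp add: names inner_commute)
  have symu: "dir_deriv w N u \<bullet> dir_deriv v X u = dir_deriv v N u \<bullet> dir_deriv w X u" if "u \<in> U" for u
    using weingarten[OF U(1) that X N XN] dir_deriv_commute[OF U(1) that X, of v w] by simp
  have sym: "N2 \<bullet> X1 = N1 \<bullet> X2" using symu[OF U(2)] by (simp add: names)
  have "dir_deriv w (\<lambda>u. dir_deriv w N u \<bullet> dir_deriv v X u) p = dir_deriv w (\<lambda>u. dir_deriv v N u \<bullet> dir_deriv w X u) p"
    by (rule dir_deriv_cong[OF U symu])
  then have sym': "N2 \<bullet> X12 + N22 \<bullet> X1 = N1 \<bullet> X22 + N12 \<bullet> X2" by (simp add: k' names)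
  have trace: "N1 \<bullet> X1 + N2 \<bullet> X2 = 0" using min[OF U(2)] by (simp add: on names)
  have "dir_deriv v (\<lambda>u. first_form X w w u * (dir_deriv v N u \<bullet> dir_deriv v X u)
      - 2 * first_form X v w u * (dir_deriv v N u \<bullet> dir_deriv w X u)
      + first_form X v v u * (dir_deriv w N u \<bullet> dir_deriv w X u)) p = dir_deriv v (\<lambda>_. 0) p"
    by (rule dir_deriv_cong[OF U min])
  then have trace': "2 * (X2 \<bullet> X12) * (N1 \<bullet> X1) + (N1 \<bullet> X11 + N11 \<bullet> X1)
      - 2 * (X1 \<bullet> X12 + X11 \<bullet> X2) * (N1 \<bullet> X2)
      + 2 * (X1 \<bullet> X11) * (N2 \<bullet> X2) + (N2 \<bullet> X12 + N12 \<bullet> X2) = 0"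
    by (simp add: dir_deriv_add dir_deriv_diff dir_deriv_mult df dk differentiable_mult differentiable_diff f' k' on)
      (simp add: names inner_commute algebra_simps)
  have t2: "N2 \<bullet> X2 = - (N1 \<bullet> X1)" using trace by simp
  have dN: "N1 = (N1 \<bullet> X1) *\<^sub>R X1 + (N1 \<bullet> X2) *\<^sub>R X2 + (N1 \<bullet> \<nu>) *\<^sub>R \<nu>"
    "N2 = (N1 \<bullet> X2) *\<^sub>R X1 + (- (N1 \<bullet> X1)) *\<^sub>R X2 + (N2 \<bullet> \<nu>) *\<^sub>R \<nu>"
    using dec[of v] dec[of w] unfolding names by (simp_all add: sym t2)
  have N1Y: "N1 \<bullet> Y = (N1 \<bullet> X1) * (X1 \<bullet> Y) + (N1 \<bullet> X2) * (X2 \<bullet> Y) + (N1 \<bullet> \<nu>) * (Y \<bullet> \<nu>)" for Y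
    using arg_cong[OF dN(1), of "\<lambda>z. z \<bullet> Y"] by (simp add: inner_simps inner_commute)
  have N2Y: "N2 \<bullet> Y = (N1 \<bullet> X2) * (X1 \<bullet> Y) - (N1 \<bullet> X1) * (X2 \<bullet> Y) + (N2 \<bullet> \<nu>) * (Y \<bullet> \<nu>)" for Y
    using arg_cong[OF dN(2), of "\<lambda>z. z \<bullet> Y"] by (simp add: inner_simps inner_commute)
  have k2: "X22 \<bullet> \<nu> = - (X11 \<bullet> \<nu>)"
    using min\<nu> by (simp add: names)
  have "N1 \<bullet> X22 - N1 \<bullet> X11 - 2 * (N2 \<bullet> X12) - 2 * (X2 \<bullet> X12) * (N1 \<bullet> X1)
      + 2 * (X1 \<bullet> X12 + X11 \<bullet> X2) * (N1 \<bullet> X2) + 2 * (X1 \<bullet> X11) * (N1 \<bullet> X1)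
      = (N1 \<bullet> X1) * (X1 \<bullet> (X11 + X22)) + (N1 \<bullet> X2) * (X2 \<bullet> (X11 + X22))"
    using EL sym' trace' by (simp add: sym t2 inner_simps)
  then have "(N1 \<bullet> \<nu>) * (X11 \<bullet> \<nu>) + (N2 \<bullet> \<nu>) * (X12 \<bullet> \<nu>) = 0"
    unfolding N1Y[of X22] N1Y[of X11] N2Y[of X12] k2
    by (simp add: inner_simps inner_commute algebra_simps)
  then show ?thesis by (simp add: names)
qed


section \<open>Change of the coordinate vectors\<close>

lemma dir_deriv_combination:
  assumes "f differentiable (at u)"
  shows "dir_deriv (a *\<^sub>R v + b *\<^sub>R w) f u = a *\<^sub>R dir_deriv v f u + b *\<^sub>R dir_deriv w f u"
proof -
  have lin: "linear (\<lambda>v. dir_deriv v f u)"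
    using has_derivative_linear[OF has_derivative_dir_deriv[OF assms]] .
  show ?thesis using linear_add[OF lin] linear_cmul[OF lin] by simp
qed

lemma gram_det_combination:
  assumes "X differentiable (at u)"
  shows "gram_det X (a *\<^sub>R v + b *\<^sub>R w) (c *\<^sub>R v + d *\<^sub>R w) u = (a * d - b * c)\<^sup>2 * gram_det X v w u"
  by (simp add: gram_det_def first_form_def dir_deriv_combination[OF assms] inner_simps)
    (simp add: inner_commute[of "dir_deriv w X u" "dir_deriv v X u"] power2_eq_square algebra_simps)

lemma dirichlet_form_combination:
  assumes "X differentiable (at u)" "A differentiable (at u)" "B differentiable (at u)"
  shows "dirichlet_form X (a *\<^sub>R v + b *\<^sub>R w) (c *\<^sub>R v + d *\<^sub>R w) A B u = (a * d - b * c)\<^sup>2 * dirichlet_form X v w A B u"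
  by (simp add: dirichlet_form_def first_form_def dir_deriv_combination[OF assms(1)]
      dir_deriv_combination[OF assms(2)] dir_deriv_combination[OF assms(3)] inner_simps)
    (simp add: inner_commute[of "dir_deriv w X u" "dir_deriv v X u"] power2_eq_square algebra_simps)

text \<open>
  Both the Dirichlet form and the Gram determinant scale by the square of the determinant of the change of
  basis, so the integrand scales by its constant absolute value.
\<close>

lemma weakly_stationary_combination:
  assumes X: "smooth_on U X" and N: "smooth_on U N" and stat: "weakly_stationary U X v w N"
  shows "weakly_stationary U X (a *\<^sub>R v + b *\<^sub>R w) (c *\<^sub>R v + d *\<^sub>R w) N"
  unfolding weakly_stationary_def
proof (intro allI impI)
  fix p q Y
  assume ab: "cbox p q \<subseteq> U" "box p q \<noteq> {}" and Y: "smooth_on U Y"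
    "\<forall>u\<in>U. u \<notin> cbox p q \<longrightarrow> Y u = 0" "\<forall>u\<in>U. Y u \<bullet> N u = 0"
  let ?e = "\<lambda>u. dirichlet_form X v w N Y u * inverse (sqrt (gram_det X v w u))"
  have eq: "dirichlet_form X (a *\<^sub>R v + b *\<^sub>R w) (c *\<^sub>R v + d *\<^sub>R w) N Y u
      * inverse (sqrt (gram_det X (a *\<^sub>R v + b *\<^sub>R w) (c *\<^sub>R v + d *\<^sub>R w) u)) = \<bar>a * d - b * c\<bar> * ?e u"
    if "u \<in> cbox p q" for u
  proof -
    have u: "u \<in> U" using that ab by blast
    have m: "m\<^sup>2 * inverse (sqrt (m\<^sup>2 * g)) = \<bar>m\<bar> * inverse (sqrt g)" for m g :: real
    proof (cases "m = 0")
      case False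
      have "sqrt (m\<^sup>2 * g) = \<bar>m\<bar> * sqrt g" "m\<^sup>2 = \<bar>m\<bar> * \<bar>m\<bar>"
        by (simp_all add: real_sqrt_mult power2_eq_square)
      then have "m\<^sup>2 * inverse (sqrt (m\<^sup>2 * g)) = (\<bar>m\<bar> * inverse \<bar>m\<bar>) * (\<bar>m\<bar> * inverse (sqrt g))"
        by (simp only: inverse_mult_distrib mult_ac)
      then show ?thesis using False by simp
    qed simp
    show ?thesis
      unfolding gram_det_combination[OF smooth_on_differentiable[OF X u]]
        dirichlet_form_combination[OF smooth_on_differentiable[OF X u] smooth_on_differentiable[OF N u]
          smooth_on_differentiable[OF Y(1) u]]
      using m[of "a * d - b * c" "gram_det X v w u"] by (simp add: mult_ac)
  qed
  have "integral (cbox p q) (\<lambda>u. \<bar>a * d - b * c\<bar> * ?e u) = 0"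
    using stat ab Y unfolding weakly_stationary_def by simp
  then show "integral (cbox p q) (\<lambda>u. dirichlet_form X (a *\<^sub>R v + b *\<^sub>R w) (c *\<^sub>R v + d *\<^sub>R w) N Y u
      * inverse (sqrt (gram_det X (a *\<^sub>R v + b *\<^sub>R w) (c *\<^sub>R v + d *\<^sub>R w) u))) = 0"
    by (rule trans[OF integral_cong, rotated]) (rule eq)
qed

lemma second_deriv_combination:
  fixes X :: "'a::real_normed_vector \<Rightarrow> 'b::euclidean_space"
  assumes U: "open U" "u \<in> U" and X: "smooth_on U X"
  shows "dir_deriv (a *\<^sub>R v + b *\<^sub>R w) (dir_deriv (c *\<^sub>R v + d *\<^sub>R w) X) u =
    (a * c) *\<^sub>R dir_deriv v (dir_deriv v X) u + (a * d + b * c) *\<^sub>R dir_deriv v (dir_deriv w X) u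
    + (b * d) *\<^sub>R dir_deriv w (dir_deriv w X) u"
proof -
  have d: "dir_deriv z X differentiable (at u)" for z
    by (rule smooth_on_differentiable[OF smooth_on_dir_deriv[OF X] U(2)])
  have sc: "(\<lambda>x. k *\<^sub>R dir_deriv z X x) differentiable (at u)" for k z
    using d by simp
  have 1: "dir_deriv y (dir_deriv (c *\<^sub>R v + d *\<^sub>R w) X) u =
      c *\<^sub>R dir_deriv y (dir_deriv v X) u + d *\<^sub>R dir_deriv y (dir_deriv w X) u" for y
  proof -
    have "dir_deriv y (dir_deriv (c *\<^sub>R v + d *\<^sub>R w) X) u =
        dir_deriv y (\<lambda>x. c *\<^sub>R dir_deriv v X x + d *\<^sub>R dir_deriv w X x) u"
      by (rule dir_deriv_cong[OF U dir_deriv_combination[OF smooth_on_differentiable[OF X]]])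
    then show ?thesis by (simp add: dir_deriv_add sc dir_deriv_scaleR d)
  qed
  have "dir_deriv (a *\<^sub>R v + b *\<^sub>R w) (dir_deriv (c *\<^sub>R v + d *\<^sub>R w) X) u =
      a *\<^sub>R dir_deriv v (dir_deriv (c *\<^sub>R v + d *\<^sub>R w) X) u + b *\<^sub>R dir_deriv w (dir_deriv (c *\<^sub>R v + d *\<^sub>R w) X) u"
    by (rule dir_deriv_combination[OF smooth_on_differentiable[OF smooth_on_dir_deriv[OF X] U(2)]])
  then show ?thesis
    unfolding 1 dir_deriv_commute[OF U X, of w v] by (simp add: algebra_simps)
qed

text \<open>
  Gram--Schmidt at one point; the coefficients are constants, so they commute with differentiation.
\<close>

lemma orthonormal_combination:
  assumes d: "X differentiable (at u)" and g: "gram_det X v w u > 0"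
  obtains a b c where "first_form X (a *\<^sub>R v + 0 *\<^sub>R w) (a *\<^sub>R v + 0 *\<^sub>R w) u = 1"
    "first_form X (b *\<^sub>R v + c *\<^sub>R w) (b *\<^sub>R v + c *\<^sub>R w) u = 1"
    "first_form X (a *\<^sub>R v + 0 *\<^sub>R w) (b *\<^sub>R v + c *\<^sub>R w) u = 0" "a * c \<noteq> 0"
proof -
  define E F G where "E = first_form X v v u" and "F = first_form X v w u" and "G = first_form X w w u"
  define D where "D = E * G - F\<^sup>2"
  have D: "D > 0" using g by (simp add: D_def gram_det_def E_def F_def G_def)
  have "E \<ge> 0" by (simp add: E_def first_form_def)
  moreover have "E \<noteq> 0" using D by (auto simp: D_def)
  ultimately have E: "E > 0" by simp
  define s t where "s = sqrt E" and "t = sqrt (E * D)"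
  have s: "s \<noteq> 0" "s * s = E" and t: "t \<noteq> 0" "t * t = E * D" using E D by (auto simp: s_def t_def)
  have ff: "first_form X (a *\<^sub>R v + b *\<^sub>R w) (c *\<^sub>R v + d *\<^sub>R w) u = a * c * E + (a * d + b * c) * F + b * d * G"
    for a b c d
    by (simp add: first_form_def dir_deriv_combination[OF d] inner_simps E_def F_def G_def)
      (simp add: inner_commute algebra_simps)
  show ?thesis
  proof
    show "first_form X ((1/s) *\<^sub>R v + 0 *\<^sub>R w) ((1/s) *\<^sub>R v + 0 *\<^sub>R w) u = 1"
      unfolding ff using s E by simp
    have "((- F) * (- F) * E + ((- F) * E + E * (- F)) * F + E * E * G) = t * t"
      by (simp add: t D_def power2_eq_square algebra_simps)
    then show "first_form X ((- F / t) *\<^sub>R v + (E / t) *\<^sub>R w) ((- F / t) *\<^sub>R v + (E / t) *\<^sub>R w) u = 1"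
      unfolding ff using t(1) by (simp add: field_simps)
    show "first_form X ((1/s) *\<^sub>R v + 0 *\<^sub>R w) ((- F / t) *\<^sub>R v + (E / t) *\<^sub>R w) u = 0"
      unfolding ff using s t by (simp add: field_simps)
    show "1 / s * (E / t) \<noteq> 0" using s t E by simp
  qed
qed

section \<open>Minimal surfaces with a stationary unit normal field\<close>

text \<open>
  The situation in one chart: \<open>X\<close> is the immersion and \<open>N\<close> the unit normal section. The assumptions on minimality
  and spanning are phrased by testing the second derivatives of \<open>X\<close> with normal vectors \<open>n\<close>, which
  avoids the projection in the second fundamental form.
\<close>

locale stationary_normal_field =
  fixes U :: "(real^2) set" and X N :: "real^2 \<Rightarrow> real^5"
  assumes U: "open U" and X: "smooth_on U X" and N: "smooth_on U N"
    and gpos: "\<And>u. u \<in> U \<Longrightarrow> gram_det X e1 e2 u > 0"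
    and XX: "\<And>u. u \<in> U \<Longrightarrow> X u \<bullet> X u = 1"
    and NN: "\<And>u. u \<in> U \<Longrightarrow> N u \<bullet> N u = 1"
    and NX: "\<And>u. u \<in> U \<Longrightarrow> N u \<bullet> X u = 0"
    and NdX: "\<And>u z. u \<in> U \<Longrightarrow> N u \<bullet> dir_deriv z X u = 0"
    and stat: "weakly_stationary U X e1 e2 N"
    and min: "\<And>u n. u \<in> U \<Longrightarrow> n \<bullet> X u = 0 \<Longrightarrow> (\<And>z. n \<bullet> dir_deriv z X u = 0) \<Longrightarrow>
      first_form X e2 e2 u * (dir_deriv e1 (dir_deriv e1 X) u \<bullet> n)
      - 2 * first_form X e1 e2 u * (dir_deriv e1 (dir_deriv e2 X) u \<bullet> n)
      + first_form X e1 e1 u * (dir_deriv e2 (dir_deriv e2 X) u \<bullet> n) = 0"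
    and spans: "\<And>u n. u \<in> U \<Longrightarrow> n \<bullet> X u = 0 \<Longrightarrow> (\<And>z. n \<bullet> dir_deriv z X u = 0) \<Longrightarrow>
      (\<And>y z. dir_deriv y (dir_deriv z X) u \<bullet> n = 0) \<Longrightarrow> n = 0"
begin

lemma diff: "u \<in> U \<Longrightarrow> X differentiable (at u)" "u \<in> U \<Longrightarrow> N differentiable (at u)"
  "u \<in> U \<Longrightarrow> dir_deriv z X differentiable (at u)" "u \<in> U \<Longrightarrow> dir_deriv z N differentiable (at u)"
  using X N smooth_on_dir_deriv smooth_on_differentiable by blast+

lemma XdX: "u \<in> U \<Longrightarrow> X u \<bullet> dir_deriv z X u = 0"
  using dir_deriv_cong[OF U _ XX, of u, where v=z] dir_deriv_inner[OF diff(1) diff(1), of u z] by (simp add: inner_commute)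

lemma NdN: "u \<in> U \<Longrightarrow> N u \<bullet> dir_deriv z N u = 0"
  using dir_deriv_cong[OF U _ NN, of u, where v=z] dir_deriv_inner[OF diff(2) diff(2), of u z] by (simp add: inner_commute)

lemma XdN: "u \<in> U \<Longrightarrow> X u \<bullet> dir_deriv z N u = 0"
  using dir_deriv_cong[OF U _ NX, of u, where v=z] dir_deriv_inner[OF diff(2) diff(1), of u z] NdX by (simp add: inner_commute)

text \<open>
  The triangular shape is what Gram--Schmidt produces from the standard basis; \<open>a * c \<noteq> 0\<close> says that
  \<open>v\<close>, \<open>w\<close> is a basis.
\<close>

definition frame :: "real^2 \<Rightarrow> real^2 \<Rightarrow> bool" where
  "frame v w \<longleftrightarrow> (\<exists>a b c. a * c \<noteq> 0 \<and> v = a *\<^sub>R e1 + 0 *\<^sub>R e2 \<and> w = b *\<^sub>R e1 + c *\<^sub>R e2)"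

definition orthonormal_frame :: "real^2 \<Rightarrow> real^2 \<Rightarrow> real^2 \<Rightarrow> bool" where
  "orthonormal_frame u v w \<longleftrightarrow> frame v w \<and> first_form X v v u = 1 \<and> first_form X w w u = 1 \<and> first_form X v w u = 0"

lemma orthonormal_frame_exists:
  assumes "u \<in> U"
  obtains v w where "orthonormal_frame u v w"
  using orthonormal_combination[OF diff(1)[OF assms] gpos[OF assms]] unfolding orthonormal_frame_def frame_def by metis

lemma frame_decompose:
  assumes "frame v w"
  obtains a b where "z = a *\<^sub>R v + b *\<^sub>R w"
proof -
  obtain a b c where abc: "a * c \<noteq> 0" "v = a *\<^sub>R e1 + 0 *\<^sub>R e2" "w = b *\<^sub>R e1 + c *\<^sub>R e2"
    using assms unfolding frame_def by blast
  have "z = ((z$1 - b * z$2 / c) / a) *\<^sub>R v + (z$2 / c) *\<^sub>R w"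
    using abc(1) by (auto simp: abc(2,3) vec_eq_iff forall_2 axis_def field_simps)
  then show ?thesis using that by blast
qed

lemma frame_gram_det_pos: "frame v w \<Longrightarrow> u \<in> U \<Longrightarrow> gram_det X v w u > 0"
  unfolding frame_def by (auto simp: gram_det_combination[OF diff(1)] gpos simp del: scaleR_zero_left add_0_right)

lemma frame_stationary:
  assumes "frame v w"
  shows "weakly_stationary U X v w N" "weakly_stationary U X w v N"
  using assms weakly_stationary_combination[OF X N stat] unfolding frame_def by blast+

lemma frame_minimal:
  assumes "frame v w" "u \<in> U" "n \<bullet> X u = 0" "\<And>z. n \<bullet> dir_deriv z X u = 0"
  shows "first_form X w w u * (dir_deriv v (dir_deriv v X) u \<bullet> n)
      - 2 * first_form X v w u * (dir_deriv v (dir_deriv w X) u \<bullet> n)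
      + first_form X v v u * (dir_deriv w (dir_deriv w X) u \<bullet> n) = 0"
proof -
  obtain a b c where abc: "v = a *\<^sub>R e1 + 0 *\<^sub>R e2" "w = b *\<^sub>R e1 + c *\<^sub>R e2"
    using assms(1) unfolding frame_def by blast
  define E F G where "E = first_form X e1 e1 u" and "F = first_form X e1 e2 u" and "G = first_form X e2 e2 u"
  have ff: "first_form X (a *\<^sub>R e1 + b *\<^sub>R e2) (c *\<^sub>R e1 + d *\<^sub>R e2) u = a * c * E + (a * d + b * c) * F + b * d * G"
    for a b c d
    by (simp add: first_form_def dir_deriv_combination[OF diff(1)[OF assms(2)]] inner_simps E_def F_def G_def)
      (simp add: inner_commute algebra_simps)
  define k11 k12 k22 where "k11 = dir_deriv e1 (dir_deriv e1 X) u \<bullet> n"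
    and "k12 = dir_deriv e1 (dir_deriv e2 X) u \<bullet> n" and "k22 = dir_deriv e2 (dir_deriv e2 X) u \<bullet> n"
  have m: "G * k11 - 2 * F * k12 + E * k22 = 0"
    using min[OF assms(2-4)] by (simp add: E_def F_def G_def k11_def k12_def k22_def)
  have "first_form X w w u * (dir_deriv v (dir_deriv v X) u \<bullet> n)
      - 2 * first_form X v w u * (dir_deriv v (dir_deriv w X) u \<bullet> n)
      + first_form X v v u * (dir_deriv w (dir_deriv w X) u \<bullet> n) = (a * c)\<^sup>2 * (G * k11 - 2 * F * k12 + E * k22)"
    unfolding abc ff second_deriv_combination[OF U assms(2) X]
    by (simp add: inner_simps k11_def[symmetric] k12_def[symmetric] k22_def[symmetric] power2_eq_square algebra_simps)
  then show ?thesis using m by simp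
qed

lemma frame_minimal_dN:
  assumes "frame v w" "u \<in> U"
  shows "first_form X w w u * (dir_deriv v N u \<bullet> dir_deriv v X u)
      - 2 * first_form X v w u * (dir_deriv v N u \<bullet> dir_deriv w X u)
      + first_form X v v u * (dir_deriv w N u \<bullet> dir_deriv w X u) = 0"
  using frame_minimal[OF assms NX[OF assms(2)] NdX[OF assms(2)]]
  by (simp add: weingarten[OF U assms(2) X N NdX] inner_commute algebra_simps)

text \<open>
  By minimality the value of the second fundamental form on \<open>(w, w)\<close> is minus that on \<open>(v, v)\<close>, so a normal vector
  orthogonal to the two values below is orthogonal to all values, and spanning applies.
\<close>

lemma normal_vector_zero:
  assumes fr: "orthonormal_frame u v w" and u: "u \<in> U"
    and n: "n \<bullet> X u = 0" "\<And>z. n \<bullet> dir_deriv z X u = 0"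
    and k: "dir_deriv v (dir_deriv v X) u \<bullet> n = 0" "dir_deriv v (dir_deriv w X) u \<bullet> n = 0"
  shows "n = 0"
proof (rule spans[OF u n])
  fix y z
  have f: "frame v w" using fr by (simp add: orthonormal_frame_def)
  have k22: "dir_deriv w (dir_deriv w X) u \<bullet> n = 0"
    using frame_minimal[OF f u n] fr k by (simp add: orthonormal_frame_def)
  obtain a b where y: "y = a *\<^sub>R v + b *\<^sub>R w" using frame_decompose[OF f] .
  obtain c d where z: "z = c *\<^sub>R v + d *\<^sub>R w" using frame_decompose[OF f] .
  show "dir_deriv y (dir_deriv z X) u \<bullet> n = 0"
    unfolding y z second_deriv_combination[OF U u X] by (simp add: inner_simps k k22)
qed

text \<open>
  The unit vectors that complete \<open>N\<close> to an orthonormal basis of the normal plane at \<open>u\<close>. They are only needed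
  at single points, so no smooth choice is made.
\<close>

definition conormal :: "real^2 \<Rightarrow> real^5 \<Rightarrow> bool" where
  "conormal u \<nu> \<longleftrightarrow> \<nu> \<bullet> \<nu> = 1 \<and> \<nu> \<bullet> X u = 0 \<and> \<nu> \<bullet> N u = 0 \<and> (\<forall>z. \<nu> \<bullet> dir_deriv z X u = 0)"

lemma conormal_exists:
  assumes "u \<in> U"
  obtains \<nu> where "conormal u \<nu>"
proof -
  define S where "S = {X u, N u, dir_deriv e1 X u, dir_deriv e2 X u}"
  have "dim S \<le> card S" by (rule dim_le_card') (simp add: S_def)
  also have "card S \<le> 4" unfolding S_def
    using card_length[of "[X u, N u, dir_deriv e1 X u, dir_deriv e2 X u]"] by simp
  finally have "dim S < DIM(real^5)" by simp
  then obtain y where y: "y \<noteq> 0" "\<And>s. s \<in> span S \<Longrightarrow> orthogonal y s"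
    using orthogonal_to_subspace_exists by blast
  have y': "y \<bullet> s = 0" if "s \<in> S" for s using y(2)[OF span_base[OF that]] by (simp add: orthogonal_def)
  have "frame e1 e2" unfolding frame_def by (rule exI[of _ 1], rule exI[of _ 0], rule exI[of _ 1]) simp
  have "y \<bullet> dir_deriv z X u = 0" for z
  proof -
    obtain a b where z: "z = a *\<^sub>R e1 + b *\<^sub>R e2" using frame_decompose[OF \<open>frame e1 e2\<close>] .
    show ?thesis unfolding z dir_deriv_combination[OF diff(1)[OF assms]]
      using y' by (simp add: inner_simps S_def)
  qed
  then have "conormal u ((1 / norm y) *\<^sub>R y)"
    using y' y(1) by (simp add: conormal_def S_def dot_square_norm power2_eq_square)
  then show ?thesis by (rule that)
qed

text \<open>
  \<open>X\<close>, \<open>N\<close>, the image of the frame and \<open>\<nu>\<close> are five orthonormal vectors, hence a basis of the ambient space.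
\<close>

lemma orthonormal_expansion:
  assumes u: "u \<in> U" and fr: "orthonormal_frame u v w" and \<nu>: "conormal u \<nu>"
    and y: "y \<bullet> X u = 0" "y \<bullet> N u = 0"
  shows "y = (y \<bullet> dir_deriv v X u) *\<^sub>R dir_deriv v X u + (y \<bullet> dir_deriv w X u) *\<^sub>R dir_deriv w X u + (y \<bullet> \<nu>) *\<^sub>R \<nu>"
proof -
  define X1 X2 where "X1 = dir_deriv v X u" and "X2 = dir_deriv w X u"
  have on: "X1 \<bullet> X1 = 1" "X2 \<bullet> X2 = 1" "X1 \<bullet> X2 = 0" "X u \<bullet> X u = 1" "N u \<bullet> N u = 1" "\<nu> \<bullet> \<nu> = 1"
    "X u \<bullet> N u = 0" "X u \<bullet> X1 = 0" "X u \<bullet> X2 = 0" "N u \<bullet> X1 = 0" "N u \<bullet> X2 = 0"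
    "\<nu> \<bullet> X1 = 0" "\<nu> \<bullet> X2 = 0" "\<nu> \<bullet> X u = 0" "\<nu> \<bullet> N u = 0"
    using fr \<nu> XX[OF u] NN[OF u] NX[OF u] XdX[OF u] NdX[OF u]
    by (auto simp: orthonormal_frame_def first_form_def conormal_def X1_def X2_def inner_commute)
  define B where "B = {X u, N u, X1, X2, \<nu>}"
  have neq: "X u \<noteq> N u" "X u \<noteq> X1" "X u \<noteq> X2" "X u \<noteq> \<nu>" "N u \<noteq> X1" "N u \<noteq> X2" "N u \<noteq> \<nu>"
    "X1 \<noteq> X2" "X1 \<noteq> \<nu>" "X2 \<noteq> \<nu>"
    using on by (metis zero_neq_one)+
  have card: "card B = 5" using neq by (simp add: B_def)
  have po: "pairwise orthogonal B"
    using on by (auto simp: pairwise_def B_def orthogonal_def inner_commute)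
  have "0 \<notin> B" using on by (auto simp: B_def)
  then have "independent B" using po pairwise_orthogonal_independent by blast
  then have sp: "UNIV \<subseteq> span B"
    by (intro card_ge_dim_independent) (auto simp: card dim_UNIV)
  define z where "z = y - ((y \<bullet> X1) *\<^sub>R X1 + (y \<bullet> X2) *\<^sub>R X2 + (y \<bullet> \<nu>) *\<^sub>R \<nu>)"
  have "orthogonal z s" if "s \<in> B" for s
    using that on y by (auto simp: B_def z_def orthogonal_def inner_simps inner_commute)
  then have "orthogonal z z" using sp orthogonal_to_span[of z B z] by (auto simp: orthogonal_commute)
  then have "z = 0" by (simp add: orthogonal_self)
  then show ?thesis by (simp add: z_def X1_def X2_def)
qed

lemma dN_expansion:
  assumes u: "u \<in> U" and fr: "orthonormal_frame u v w" and \<nu>: "conormal u \<nu>"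
  shows "dir_deriv z N u = (dir_deriv z N u \<bullet> dir_deriv v X u) *\<^sub>R dir_deriv v X u
    + (dir_deriv z N u \<bullet> dir_deriv w X u) *\<^sub>R dir_deriv w X u + (dir_deriv z N u \<bullet> \<nu>) *\<^sub>R \<nu>"
  by (rule orthonormal_expansion[OF assms]) (use XdN[OF u] NdN[OF u] in \<open>simp_all add: inner_commute\<close>)

lemma trace_conormal:
  assumes u: "u \<in> U" and fr: "orthonormal_frame u v w" and \<nu>: "conormal u \<nu>"
  shows "dir_deriv v (dir_deriv v X) u \<bullet> \<nu> + dir_deriv w (dir_deriv w X) u \<bullet> \<nu> = 0"
  using frame_minimal[of v w u \<nu>] assms by (simp add: orthonormal_frame_def conormal_def)

text \<open>
  The two components of \<open>S\<^sub>\<nu> \<omega> = 0\<close>, the second one obtained by exchanging \<open>v\<close> and \<open>w\<close>, form a linear system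
  for \<open>\<omega>\<close> with determinant \<open>- (k11\<^sup>2 + k12\<^sup>2)\<close>, which is nonzero by spanning.
\<close>

lemma dN_conormal:
  assumes u: "u \<in> U" and fr: "orthonormal_frame u v w" and \<nu>: "conormal u \<nu>"
  shows "dir_deriv z N u \<bullet> \<nu> = 0"
proof -
  have f: "frame v w" and on: "first_form X v v u = 1" "first_form X w w u = 1" "first_form X v w u = 0"
    using fr by (auto simp: orthonormal_frame_def)
  have sym: "first_form X w v x = first_form X v w x" for x by (simp add: first_form_def inner_commute)
  have gsym: "gram_det X w v x = gram_det X v w x" for x by (simp add: gram_det_def sym)
  define \<omega>1 \<omega>2 k11 k12 where "\<omega>1 = dir_deriv v N u \<bullet> \<nu>" and "\<omega>2 = dir_deriv w N u \<bullet> \<nu>"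
    and "k11 = dir_deriv v (dir_deriv v X) u \<bullet> \<nu>" and "k12 = dir_deriv v (dir_deriv w X) u \<bullet> \<nu>"
  have k22: "dir_deriv w (dir_deriv w X) u \<bullet> \<nu> = - k11"
    using trace_conormal[OF assms] by (simp add: k11_def)
  have qsym: "dir_deriv w N x \<bullet> dir_deriv v X x = dir_deriv v N x \<bullet> dir_deriv w X x" if "x \<in> U" for x
    using weingarten[OF U that X N NdX] dir_deriv_commute[OF U that X, of v w] by simp
  have 1: "\<omega>1 * k11 + \<omega>2 * k12 = 0"
    using stationary_normal_connection[OF U u X N NdX frame_gram_det_pos[OF f] frame_stationary(1)[OF f]
        frame_minimal_dN[OF f] on dN_expansion[OF assms] trace_conormal[OF assms]]
    by (simp add: \<omega>1_def \<omega>2_def k11_def k12_def)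
  have "\<omega>2 * (- k11) + \<omega>1 * k12 = 0"
    unfolding \<omega>1_def \<omega>2_def k22[symmetric] k12_def dir_deriv_commute[OF U u X, of v w]
  proof (rule stationary_normal_connection[OF U u X N NdX _ frame_stationary(2)[OF f] _ on(2,1)])
    show "gram_det X w v x > 0" if "x \<in> U" for x using frame_gram_det_pos[OF f that] by (simp add: gsym)
    show "first_form X w v u = 0" by (simp add: sym on)
    show "first_form X v v x * (dir_deriv w N x \<bullet> dir_deriv w X x)
      - 2 * first_form X w v x * (dir_deriv w N x \<bullet> dir_deriv v X x)
      + first_form X w w x * (dir_deriv v N x \<bullet> dir_deriv v X x) = 0" if "x \<in> U" for x
      using frame_minimal_dN[OF f that] by (simp add: sym qsym[OF that])
    show "dir_deriv z N u = (dir_deriv z N u \<bullet> dir_deriv w X u) *\<^sub>R dir_deriv w X u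
      + (dir_deriv z N u \<bullet> dir_deriv v X u) *\<^sub>R dir_deriv v X u + (dir_deriv z N u \<bullet> \<nu>) *\<^sub>R \<nu>" for z
      using dN_expansion[OF assms, of z] by (simp add: add_ac)
    show "dir_deriv w (dir_deriv w X) u \<bullet> \<nu> + dir_deriv v (dir_deriv v X) u \<bullet> \<nu> = 0"
      using trace_conormal[OF assms] by simp
  qed
  then have 2: "\<omega>1 * k12 = \<omega>2 * k11" by simp
  have "\<nu> \<noteq> 0" using \<nu> by (auto simp: conormal_def)
  then have "k11 \<noteq> 0 \<or> k12 \<noteq> 0"
    using normal_vector_zero[OF fr u, of \<nu>] \<nu> by (auto simp: conormal_def k11_def k12_def)
  then have K: "k11 * k11 + k12 * k12 \<noteq> 0" by (simp add: sum_squares_eq_zero_iff)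
  have "\<omega>1 * (k11 * k11 + k12 * k12) = (\<omega>1 * k11 + \<omega>2 * k12) * k11 + (\<omega>1 * k12 - \<omega>2 * k11) * k12"
    by (simp add: algebra_simps)
  also have "\<dots> = 0" using 1 2 by simp
  finally have o1: "\<omega>1 = 0" using K mult_eq_0_iff by blast
  have "\<omega>2 * (k11 * k11 + k12 * k12) = (\<omega>1 * k11 + \<omega>2 * k12) * k12 - (\<omega>1 * k12 - \<omega>2 * k11) * k11"
    by (simp add: algebra_simps)
  also have "\<dots> = 0" using 1 2 by simp
  finally have o2: "\<omega>2 = 0" using K mult_eq_0_iff by blast
  obtain a b where z: "z = a *\<^sub>R v + b *\<^sub>R w" using frame_decompose[OF f] .
  show ?thesis unfolding z dir_deriv_combination[OF diff(2)[OF u]]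
    using o1 o2 by (simp add: inner_simps \<omega>1_def \<omega>2_def)
qed

lemma dN_tangent:
  assumes "u \<in> U"
  obtains y where "dir_deriv z N u = dir_deriv y X u"
proof -
  obtain v w where fr: "orthonormal_frame u v w" using orthonormal_frame_exists[OF assms] .
  obtain \<nu> where \<nu>: "conormal u \<nu>" using conormal_exists[OF assms] .
  have "dir_deriv z N u = dir_deriv ((dir_deriv z N u \<bullet> dir_deriv v X u) *\<^sub>R v + (dir_deriv z N u \<bullet> dir_deriv w X u) *\<^sub>R w) X u"
    unfolding dir_deriv_combination[OF diff(1)[OF assms]]
    using dN_expansion[OF assms fr \<nu>, of z] dN_conormal[OF assms fr \<nu>] by simp
  then show ?thesis by (rule that)
qed

text \<open>
  Solving for the coefficients of \<open>dN\<close> in a fixed frame gives an identity between smooth functions on all of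
  \<open>U\<close>, which can be differentiated; the frame is orthonormal only at one point.
\<close>

lemma dN_solved:
  assumes u: "u \<in> U" and f: "frame v w"
  shows "gram_det X v w u *\<^sub>R dir_deriv z N u =
    (first_form X w w u * (dir_deriv z N u \<bullet> dir_deriv v X u) - first_form X v w u * (dir_deriv z N u \<bullet> dir_deriv w X u)) *\<^sub>R dir_deriv v X u
  + (first_form X v v u * (dir_deriv z N u \<bullet> dir_deriv w X u) - first_form X v w u * (dir_deriv z N u \<bullet> dir_deriv v X u)) *\<^sub>R dir_deriv w X u"
proof -
  obtain y where y: "dir_deriv z N u = dir_deriv y X u" using dN_tangent[OF u] .
  obtain a b where ab: "y = a *\<^sub>R v + b *\<^sub>R w" using frame_decompose[OF f] .
  have dN: "dir_deriv z N u = a *\<^sub>R dir_deriv v X u + b *\<^sub>R dir_deriv w X u"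
    by (simp add: y ab dir_deriv_combination[OF diff(1)[OF u]])
  have "first_form X w w u * (dir_deriv z N u \<bullet> dir_deriv v X u) - first_form X v w u * (dir_deriv z N u \<bullet> dir_deriv w X u) = gram_det X v w u * a"
    "first_form X v v u * (dir_deriv z N u \<bullet> dir_deriv w X u) - first_form X v w u * (dir_deriv z N u \<bullet> dir_deriv v X u) = gram_det X v w u * b"
    by (simp_all add: dN inner_simps gram_det_def first_form_def power2_eq_square inner_commute algebra_simps)
  then show ?thesis by (simp add: dN scaleR_add_right)
qed

text \<open>
  In the derivative of \<open>dN_solved\<close> along \<open>y\<close>, tested with the fixed vector \<open>\<nu>\<close>, all terms with derivatives of the
  coefficients drop out because \<open>\<nu>\<close> is orthogonal to \<open>dX\<close> and \<open>dN\<close> at \<open>u\<close>.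
\<close>

lemma second_deriv_N_conormal:
  assumes u: "u \<in> U" and fr: "orthonormal_frame u v w" and \<nu>: "conormal u \<nu>"
  shows "dir_deriv y (dir_deriv z N) u \<bullet> \<nu> =
    (dir_deriv z N u \<bullet> dir_deriv v X u) * (dir_deriv y (dir_deriv v X) u \<bullet> \<nu>)
  + (dir_deriv z N u \<bullet> dir_deriv w X u) * (dir_deriv y (dir_deriv w X) u \<bullet> \<nu>)"
proof -
  have f: "frame v w" and on: "first_form X v v u = 1" "first_form X w w u = 1" "first_form X v w u = 0"
    using fr by (auto simp: orthonormal_frame_def)
  define P where "P x = first_form X w w x * (dir_deriv z N x \<bullet> dir_deriv v X x) - first_form X v w x * (dir_deriv z N x \<bullet> dir_deriv w X x)" for x
  define Q where "Q x = first_form X v v x * (dir_deriv z N x \<bullet> dir_deriv w X x) - first_form X v w x * (dir_deriv z N x \<bullet> dir_deriv v X x)" for x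
  have P: "smooth_on U P" unfolding P_def[abs_def]
    by (intro smooth_on_diff smooth_on_mult smooth_on_inner smooth_on_first_form smooth_on_dir_deriv U X N)
  have Q: "smooth_on U Q" unfolding Q_def[abs_def]
    by (intro smooth_on_diff smooth_on_mult smooth_on_inner smooth_on_first_form smooth_on_dir_deriv U X N)
  have g: "gram_det X v w differentiable at u"
    by (rule smooth_on_differentiable[OF smooth_on_gram_det[OF U X] u])
  have c: "(\<lambda>x. h x \<bullet> \<nu>) differentiable (at u)" if "h differentiable (at u)" for h :: "real^2 \<Rightarrow> real^5"
    using that by simp
  have dc: "dir_deriv y (\<lambda>x. h x \<bullet> \<nu>) u = dir_deriv y h u \<bullet> \<nu>" if "h differentiable (at u)" for h :: "real^2 \<Rightarrow> real^5"
    using dir_deriv_inner[OF that, of "\<lambda>_. \<nu>" y] by simp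
  have "gram_det X v w x * (dir_deriv z N x \<bullet> \<nu>) = P x * (dir_deriv v X x \<bullet> \<nu>) + Q x * (dir_deriv w X x \<bullet> \<nu>)" if "x \<in> U" for x
    using arg_cong[OF dN_solved[OF that f, of z], of "\<lambda>h. h \<bullet> \<nu>"] by (simp add: inner_simps P_def Q_def)
  then have "dir_deriv y (\<lambda>x. gram_det X v w x * (dir_deriv z N x \<bullet> \<nu>)) u =
      dir_deriv y (\<lambda>x. P x * (dir_deriv v X x \<bullet> \<nu>) + Q x * (dir_deriv w X x \<bullet> \<nu>)) u"
    by (rule dir_deriv_cong[OF U u])
  moreover have "dir_deriv v X u \<bullet> \<nu> = 0" "dir_deriv w X u \<bullet> \<nu> = 0"
    using \<nu> by (simp_all add: conormal_def inner_commute)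
  moreover have "gram_det X v w u = 1" by (simp add: gram_det_def on)
  ultimately show ?thesis
    using dN_conormal[OF assms, of z] smooth_on_differentiable[OF P u] smooth_on_differentiable[OF Q u]
    by (simp add: dir_deriv_mult dir_deriv_add g c dc diff[OF u] differentiable_mult P_def[of u] Q_def[of u] on)
qed

text \<open>
  The symmetry of the second derivative of \<open>N\<close>, tested with \<open>\<nu>\<close>, is the Ricci equation for a parallel normal
  field. It makes the trace free matrices \<open>k\<close> and \<open>q\<close> proportional, and then
  \<open>k11 N + q11 \<nu>\<close> and \<open>k12 N + q12 \<nu>\<close> are orthogonal to the second fundamental form, hence zero.
  So \<open>k\<close> vanishes, and \<open>\<nu>\<close> itself contradicts spanning.
\<close>

lemma empty: "U = {}"
proof (rule ccontr)
  assume "U \<noteq> {}"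
  then obtain u where u: "u \<in> U" by blast
  obtain v w where fr: "orthonormal_frame u v w" using orthonormal_frame_exists[OF u] .
  obtain \<nu> where \<nu>: "conormal u \<nu>" using conormal_exists[OF u] .
  have f: "frame v w" and on: "first_form X v v u = 1" "first_form X w w u = 1" "first_form X v w u = 0"
    using fr by (auto simp: orthonormal_frame_def)
  define k11 k12 where "k11 = dir_deriv v (dir_deriv v X) u \<bullet> \<nu>" and "k12 = dir_deriv v (dir_deriv w X) u \<bullet> \<nu>"
  define q11 q12 where "q11 = dir_deriv v N u \<bullet> dir_deriv v X u" and "q12 = dir_deriv v N u \<bullet> dir_deriv w X u"
  have k: "dir_deriv w (dir_deriv w X) u \<bullet> \<nu> = - k11" "dir_deriv w (dir_deriv v X) u \<bullet> \<nu> = k12"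
    using trace_conormal[OF u fr \<nu>] dir_deriv_commute[OF U u X, of v w] by (simp_all add: k11_def k12_def)
  have wn: "dir_deriv y (dir_deriv z X) u \<bullet> N u = - (dir_deriv y N u \<bullet> dir_deriv z X u)" for y z
    using weingarten[OF U u X N NdX, of y z] by (simp add: inner_commute)
  have q21: "dir_deriv w N u \<bullet> dir_deriv v X u = q12"
    using wn[of v w] wn[of w v] dir_deriv_commute[OF U u X, of v w] by (simp add: q12_def)
  have q22: "dir_deriv w N u \<bullet> dir_deriv w X u = - q11"
    using frame_minimal_dN[OF f u] by (simp add: on q11_def)
  have "q12 * k11 - q11 * k12 = q11 * k12 - q12 * k11"
    using second_deriv_N_conormal[OF u fr \<nu>, of v w] second_deriv_N_conormal[OF u fr \<nu>, of w v]
      dir_deriv_commute[OF U u N, of v w]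
    by (simp add: k q21 q22 k11_def[symmetric] k12_def[symmetric] q11_def[symmetric] q12_def[symmetric])
  then have parallel: "q12 * k11 = q11 * k12" by linarith
  have zero: "a *\<^sub>R N u + b *\<^sub>R \<nu> = 0" if "a * q11 = b * k11" "a * q12 = b * k12" for a b
  proof (rule normal_vector_zero[OF fr u])
    show "(a *\<^sub>R N u + b *\<^sub>R \<nu>) \<bullet> X u = 0" "(a *\<^sub>R N u + b *\<^sub>R \<nu>) \<bullet> dir_deriv z X u = 0" for z
      using NX[OF u] NdX[OF u] \<nu> by (simp_all add: inner_simps conormal_def)
    show "dir_deriv v (dir_deriv v X) u \<bullet> (a *\<^sub>R N u + b *\<^sub>R \<nu>) = 0" "dir_deriv v (dir_deriv w X) u \<bullet> (a *\<^sub>R N u + b *\<^sub>R \<nu>) = 0"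
      using that by (simp_all add: inner_simps wn k11_def[symmetric] k12_def[symmetric] q11_def[symmetric] q12_def[symmetric])
  qed
  have coef: "a = 0" if "a *\<^sub>R N u + b *\<^sub>R \<nu> = 0" for a b
    using arg_cong[OF that, of "\<lambda>h. h \<bullet> N u"] NN[OF u] \<nu> by (simp add: inner_simps conormal_def)
  have "k11 = 0" by (rule coef[OF zero[of k11 q11]]) (use parallel in \<open>simp_all add: mult_ac\<close>)
  moreover have "k12 = 0" by (rule coef[OF zero[of k12 q12]]) (use parallel in \<open>simp_all add: mult_ac\<close>)
  ultimately have "0 *\<^sub>R N u + 1 *\<^sub>R \<nu> = 0" by (intro zero) auto
  then show False using \<nu> by (auto simp: conormal_def)
qed

end

section \<open>From the surface to the chart\<close>

lemma orth_proj_subspace: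
  assumes "subspace W"
  shows "orth_proj W a \<in> W" "n \<in> W \<Longrightarrow> orth_proj W a \<bullet> n = a \<bullet> n"
proof -
  obtain y z where yz: "y \<in> span W" "\<And>w. w \<in> span W \<Longrightarrow> orthogonal z w" "a = y + z"
    using orthogonal_subspace_decomp_exists[of W a] by blast
  have sW: "span W = W" using assms by (simp add: span_eq_iff)
  have "orth_proj W a = y" unfolding orth_proj_def
  proof (rule the_equality)
    show "y \<in> W \<and> (\<forall>w\<in>W. orthogonal (a - y) w)" using yz sW by auto
    fix n assume n: "n \<in> W \<and> (\<forall>w\<in>W. orthogonal (a - n) w)"
    then have d: "n - y \<in> W" using assms yz(1) sW by (simp add: subspace_diff)
    then have "(a - n) \<bullet> (n - y) = 0" "z \<bullet> (n - y) = 0" using n yz(2) sW by (auto simp: orthogonal_def)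
    then have "(n - y) \<bullet> (n - y) = 0" by (simp add: yz(3) inner_simps)
    then show "n = y" by simp
  qed
  with yz sW show "orth_proj W a \<in> W" "n \<in> W \<Longrightarrow> orth_proj W a \<bullet> n = a \<bullet> n"
    by (auto simp: inner_add_left orthogonal_def)
qed

lemma subspace_normal_space: "subspace (normal_space c x p)"
  by (auto simp: subspace_def normal_space_def inner_simps)

lemma normal_space_chart:
  assumes "u \<in> chart_image c"
  shows "n \<in> normal_space c x (chart_inv c u) \<longleftrightarrow>
    n \<bullet> local_rep c x u = 0 \<and> (\<forall>z. n \<bullet> dir_deriv z (local_rep c x) u = 0)"
  by (simp add: normal_space_def differential_def chart_map_inv[OF assms] dir_deriv_def local_rep_def[of c x])

lemma second_fundamental_form_inner:
  assumes "u \<in> chart_image c" "n \<in> normal_space c x (chart_inv c u)"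
  shows "second_fundamental_form c x (chart_inv c u) v w \<bullet> n = dir_deriv v (dir_deriv w (local_rep c x)) u \<bullet> n"
  using orth_proj_subspace(2)[OF subspace_normal_space assms(2)]
  by (simp add: second_fundamental_form_def chart_map_inv[OF assms(1)] dir_deriv_def[abs_def])

theorem theorem1p3:
  fixes \<A> :: "'m::{t2_space, second_countable_topology} chart set"
    and x \<eta> :: "'m \<Rightarrow> real^5"
  assumes "smooth_atlas \<A>"
    and "minimal_in_sphere \<A> x"
    and "second_fundamental_form_spans \<A> x"
    and "unit_normal_section \<A> x \<eta>"
  shows "\<not> harmonic_into_sphere \<A> x \<eta>"
proof
  assume harm: "harmonic_into_sphere \<A> x \<eta>"
  have im: "immersed_in_sphere \<A> x" using assms(2) by (simp add: minimal_in_sphere_def)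
  obtain c p where c: "c \<in> \<A>" "p \<in> chart_dom c"
    using assms(1) unfolding smooth_atlas_def by blast
  define U X N where "U = chart_image c" and "X = local_rep c x" and "N = local_rep c \<eta>"
  note cc = smooth_atlasD[OF assms(1) c(1)]
  have dom: "chart_inv c u \<in> chart_dom c" if "u \<in> U" for u using chart_inv_in_dom that by (simp add: U_def)
  have gpos: "gram_det X e1 e2 u > 0" if "u \<in> U" for u
    using gram_det_chart_pos[OF assms(1) im c(1) _ axis_independent] that by (simp add: X_def U_def)
  have nrm: "n \<in> normal_space c x (chart_inv c u) \<longleftrightarrow> n \<bullet> X u = 0 \<and> (\<forall>z. n \<bullet> dir_deriv z X u = 0)"
    if "u \<in> U" for u n using normal_space_chart that by (simp add: U_def X_def)
  have Nn: "N u \<in> normal_space c x (chart_inv c u)" if "u \<in> U" for u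
    using assms(4) c dom[OF that] by (simp add: unit_normal_section_def N_def local_rep_def)
  have U: "open U" using cc by (simp add: U_def)
  have X: "smooth_on U X" using im c by (simp add: immersed_in_sphere_def smooth_map_def U_def X_def)
  have "stationary_normal_field U X N"
  proof
    show "open U" "smooth_on U X" by (rule U, rule X)
    show "smooth_on U N" using assms(4) c by (simp add: unit_normal_section_def smooth_map_def U_def N_def)
    show "gram_det X e1 e2 u > 0" if "u \<in> U" for u using gpos[OF that] .
    show "X u \<bullet> X u = 1" for u
      using im by (simp add: immersed_in_sphere_def X_def local_rep_def dot_square_norm)
    show "N u \<bullet> N u = 1" for u
      using assms(4) by (simp add: unit_normal_section_def N_def local_rep_def dot_square_norm)
    show "N u \<bullet> X u = 0" "N u \<bullet> dir_deriv z X u = 0" if "u \<in> U" for u z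
      using Nn[OF that] nrm[OF that] by auto
    show "weakly_stationary U X e1 e2 N"
      unfolding weakly_stationary_def U_def X_def N_def
      using first_variation[OF assms(1) c(1) im harm] by blast
  next
    fix u n assume u: "u \<in> U" and n: "n \<bullet> X u = 0" "\<And>z. n \<bullet> dir_deriv z X u = 0"
    have nn: "n \<in> normal_space c x (chart_inv c u)" using n nrm[OF u] by blast
    have u': "u \<in> chart_image c" using u by (simp add: U_def)
    note sff = second_fundamental_form_inner[OF u' nn, folded X_def]
    define g where "g = gram_det X e1 e2 u"
    have g: "g > 0" "det (gram c x (chart_inv c u)) = g" using gpos[OF u] det_gram[OF u', of x] by (simp_all add: g_def X_def)
    have "mean_curvature c x (chart_inv c u) \<bullet> n = 0"
      using assms(2) c dom[OF u] by (simp add: minimal_in_sphere_def)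
    then have "(first_form X e2 e2 u * (dir_deriv e1 (dir_deriv e1 X) u \<bullet> n)
      - first_form X e1 e2 u * (dir_deriv e1 (dir_deriv e2 X) u \<bullet> n)
      - first_form X e2 e1 u * (dir_deriv e2 (dir_deriv e1 X) u \<bullet> n)
      + first_form X e1 e1 u * (dir_deriv e2 (dir_deriv e2 X) u \<bullet> n)) / g = 0"
      using g by (simp add: mean_curvature_def sum_2 inner_add_left inner_diff_left inner_scaleR_left matrix_inv_2 sff
          gram_eq_first_form[OF u', of x, folded X_def] diff_divide_distrib add_divide_distrib)
    then show "first_form X e2 e2 u * (dir_deriv e1 (dir_deriv e1 X) u \<bullet> n)
      - 2 * first_form X e1 e2 u * (dir_deriv e1 (dir_deriv e2 X) u \<bullet> n)
      + first_form X e1 e1 u * (dir_deriv e2 (dir_deriv e2 X) u \<bullet> n) = 0"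
      using g dir_deriv_commute[OF U u X, of e2 e1]
      by (simp add: first_form_def inner_commute mult_ac)
    assume z: "\<And>y z. dir_deriv y (dir_deriv z X) u \<bullet> n = 0"
    have "n \<in> span {second_fundamental_form c x (chart_inv c u) v w | v w. True}"
      using assms(3) c dom[OF u] nn by (simp add: second_fundamental_form_spans_def)
    moreover have "orthogonal n b" if "b \<in> {second_fundamental_form c x (chart_inv c u) v w | v w. True}" for b
      using that z sff by (auto simp: orthogonal_def inner_commute)
    ultimately have "orthogonal n n" by (rule orthogonal_to_span)
    then show "n = 0" by (simp add: orthogonal_self)
  qed
  then have "U = {}" by (rule stationary_normal_field.empty)
  then show False using cc(6)[OF c(2)] by (simp add: U_def)
qed

end
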